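(* Let $k\ge 1$ be an integer, let $N(k)=4k(4k+1)$, and let $X_{1,t},X_{2,t},Y_t$ ($t=1,2,\dots,4k-1$) be indeterminates. Define \begin{align*} f_0(t,j)&=((N(k)+j)Y_t-X_{2,t})(-4)^k,\\ f_1(t,j)&=-((4N(k)+4j+2)Y_t-4X_{1,t})(-4)^k,\\ g_0(t,j)&=X_{2,t}-jY_t,\\ g_1(t,j)&=-(4X_{1,t}-(4j+2)Y_t). \end{align*} For $\ell=1,2,\dots,4k$ let $F^X_\ell$ (resp.\ $G^X_\ell$) be the $(4k-1)\times(4k)$ matrix whose only nonzero entries are, for $t=1,\dots,4k-1$, the $(t,t)$-entry $f_1(t,4(\ell-1)k+t)$ and the $(t,t+1)$-entry $f_0(t,4(\ell-1)k+t+1)$ (resp.\ the $(t,t)$-entry $g_1(t,4(\ell-1)k+t)$ and the $(t,t+1)$-entry $g_0(t,4(\ell-1)k+t+1)$). For $\ell=1,\dots,4k$ let $x_\ell$ be the row vector of length $4k$ whose entries are all zero except the last one, which equals $$u_\ell=(-1)^{\ell-1}(-4)^{(\ell+1)k}\,8k(4k+1)\left(\prod_{i=1}^{4k-\ell}(4ik-1)\right)\left(\prod_{i=1}^{\ell-1}(4ik+1)\right).$$ Let $M^X$ be the $16k^2\times 16k^2$ block matrix $$M^X=\begin{pmatrix} x_1&x_2&x_3&\dots&x_{4k}\\ F^X_1&0&0&\dots&0\\ G^X_1&F^X_2&0&\dots&0\\ 0&G^X_2&F^X_3&\dots&0\\ \vdots&&\ddots&\ddots&\vdots\\ & & &G^X_{4k-1}&F^X_{4k}\\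 0& \dots& &0 & G^X_{4k} \end{pmatrix},$$ i.e.\ a first row $(x_1,\dots,x_{4k})$ followed by $4k+1$ block rows, the $r$-th of which has $F^X_r$ in block column $r$ (for $r\le 4k$) and $G^X_{r-1}$ in block column $r-1$ (for $r\ge 2$), all other blocks zero. Then \begin{multline*} \det M^X=(-1)^{k-1}4^{2k(4k^2+7k+2)}k^{2k(4k+1)} \prod _{i=1} ^{4k}(i+1)_{4k-i+1} \times \prod _{a=1}^{4k-1}\left(2X_{1,a}-(32k^2+2a-1)Y_a\right)\\ \times \prod _{1\le a\le b\le 4k-1} (2X_{2,b}Y_a-2X_{1,a}Y_b-(2b-2a+1)Y_aY_b), \end{multline*} where $(\alpha)_k:=\alpha(\alpha+1)\cdots(\alpha+k-1)$ for $k\ge1$ and $(\alpha)_0:=1$ (shifted factorials).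
   Context: This determinant arises in proving that, for every $k\ge1$, a series $\pi=\sum_{n\ge0} S_k(n)/\big(\binom{8kn}{4kn}(-4)^{kn}\big)$ with $S_k$ a polynomial of degree $4k$ exists: the coefficient matrix of the linear system determining $S_k$ has determinant equal (up to nonzero factors) to $\det M^X$ specialized at $X_{1,t}=X_{2,t}=N(k)$, $Y_t=1$, which is nonzero by the formula. *)

theory Defs
  imports "Jordan_Normal_Form.Determinant"
begin

text \<open>Entries of the block matrix M^X, with indeterminates X1 t = X_{1,t}, X2 t = X_{2,t}, Y t = Y_t
  (indexed t = 1..4k-1), evaluated in an arbitrary commutative ring.
  Matrix rows/columns are 0-based.\<close>

definition NN :: "nat \<Rightarrow> nat" where "NN k = 4*k*(4*k+1)"

definition ff0 :: "nat \<Rightarrow> (nat \<Rightarrow> 'a::comm_ring_1) \<Rightarrow> (nat \<Rightarrow> 'a) \<Rightarrow> (nat \<Rightarrow> 'a) \<Rightarrow> nat \<Rightarrow> nat \<Rightarrow> 'a" where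
  "ff0 k X1 X2 Y t j = ((of_nat (NN k + j)) * Y t - X2 t) * (-4)^k"

definition ff1 :: "nat \<Rightarrow> (nat \<Rightarrow> 'a::comm_ring_1) \<Rightarrow> (nat \<Rightarrow> 'a) \<Rightarrow> (nat \<Rightarrow> 'a) \<Rightarrow> nat \<Rightarrow> nat \<Rightarrow> 'a" where
  "ff1 k X1 X2 Y t j = - ((of_nat (4 * NN k + 4*j + 2)) * Y t - 4 * X1 t) * (-4)^k"

definition gg0 :: "nat \<Rightarrow> (nat \<Rightarrow> 'a::comm_ring_1) \<Rightarrow> (nat \<Rightarrow> 'a) \<Rightarrow> (nat \<Rightarrow> 'a) \<Rightarrow> nat \<Rightarrow> nat \<Rightarrow> 'a" where
  "gg0 k X1 X2 Y t j = X2 t - of_nat j * Y t"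

definition gg1 :: "nat \<Rightarrow> (nat \<Rightarrow> 'a::comm_ring_1) \<Rightarrow> (nat \<Rightarrow> 'a) \<Rightarrow> (nat \<Rightarrow> 'a) \<Rightarrow> nat \<Rightarrow> nat \<Rightarrow> 'a" where
  "gg1 k X1 X2 Y t j = - (4 * X1 t - of_nat (4*j + 2) * Y t)"

definition uu :: "nat \<Rightarrow> nat \<Rightarrow> 'a::comm_ring_1" where
  "uu k l = (-1)^(l-1) * (-4)^((l+1)*k) * of_nat (8*k*(4*k+1))
     * of_nat (\<Prod>i\<in>{1..4*k-l}. 4*i*k - 1) * of_nat (\<Prod>i\<in>{1..l-1}. 4*i*k + 1)"

text \<open>Block F^X_l (1-based t = row, s = column in block).\<close>
definition FX :: "nat \<Rightarrow> (nat \<Rightarrow> 'a::comm_ring_1) \<Rightarrow> (nat \<Rightarrow> 'a) \<Rightarrow> (nat \<Rightarrow> 'a) \<Rightarrow> nat \<Rightarrow> nat \<Rightarrow> nat \<Rightarrow> 'a" where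
  "FX k X1 X2 Y l t s =
     (if s = t then ff1 k X1 X2 Y t (4*(l-1)*k + t)
      else if s = t + 1 then ff0 k X1 X2 Y t (4*(l-1)*k + t + 1) else 0)"

definition GX :: "nat \<Rightarrow> (nat \<Rightarrow> 'a::comm_ring_1) \<Rightarrow> (nat \<Rightarrow> 'a) \<Rightarrow> (nat \<Rightarrow> 'a) \<Rightarrow> nat \<Rightarrow> nat \<Rightarrow> nat \<Rightarrow> 'a" where
  "GX k X1 X2 Y l t s =
     (if s = t then gg1 k X1 X2 Y t (4*(l-1)*k + t)
      else if s = t + 1 then gg0 k X1 X2 Y t (4*(l-1)*k + t + 1) else 0)"

text \<open>Entry (r,c), 0-based, of M^X. Row 0 is (x_1,...,x_{4k}); rows 1.. form 4k+1 block rows of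
  height 4k-1; block row R (1-based) has F_R in block column R and G_{R-1} in block column R-1.\<close>
definition MX_entry :: "nat \<Rightarrow> (nat \<Rightarrow> 'a::comm_ring_1) \<Rightarrow> (nat \<Rightarrow> 'a) \<Rightarrow> (nat \<Rightarrow> 'a) \<Rightarrow> nat \<Rightarrow> nat \<Rightarrow> 'a" where
  "MX_entry k X1 X2 Y r c =
     (let C = c div (4*k) + 1; s = c mod (4*k) + 1 in
      if r = 0 then (if s = 4*k then uu k C else 0)
      else (let R = (r - 1) div (4*k - 1) + 1; t = (r - 1) mod (4*k - 1) + 1 in
            if C = R then FX k X1 X2 Y R t s
            else if C + 1 = R then GX k X1 X2 Y C t s
            else 0))"

definition MX :: "nat \<Rightarrow> (nat \<Rightarrow> 'a::comm_ring_1) \<Rightarrow> (nat \<Rightarrow> 'a) \<Rightarrow> (nat \<Rightarrow> 'a) \<Rightarrow> 'a mat" where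
  "MX k X1 X2 Y = mat (16*k^2) (16*k^2) (\<lambda>(r,c). MX_entry k X1 X2 Y r c)"

end

theory Submission
  imports Defs "HOL-Library.Poly_Mapping" "HOL-Computational_Algebra.Fraction_Field"
begin

text \<open>
  Put \<open>m = 4k\<close>, \<open>q = (-4)^k\<close>, \<open>N = m(m+1)\<close>, and encode the block vector attached to a residue \<open>s\<close>
  as a polynomial \<open>V_s(z)\<close> of degree less than \<open>m\<close>. Assume first that the \<open>Y_t\<close> are units and set
  \<open>\<alpha>_t = X_{1,t}/Y_t - t - 1/2\<close>, \<open>\<beta>_t = X_{2,t}/Y_t - t - 1\<close>. Then the rows of index \<open>t\<close> read
  \<open>Y_t (4 (\<alpha>_t E - D) V_t - (\<beta>_t E - D) V_{t+1})\<close> with \<open>E V = (q - z) V\<close> and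
  \<open>D V = q N V + m (q - z) z V'\<close>. So only one matrix pencil \<open>\<lambda> E - D\<close> occurs. In the basis of powers
  of \<open>q - z\<close> it is bidiagonal, and it becomes multiplication by \<open>\<lambda> - x\<close> on polynomials in a variable \<open>x\<close>.
  In the Newton basis \<open>\<Prod>_{a \<le> j} (\<alpha>_a - x)\<close> exactly one permutation contributes to the
  Leibniz expansion; its entries are the factors \<open>\<beta>_b - \<alpha>_a\<close>. By the Chu-Vandermonde identity the first row
  becomes a multiple of the evaluation at \<open>x = m^2 - 1\<close>, which gives the factors linear in \<open>X_{1,a}\<close>.
  The general case follows by specialising the identity over the field of fractions of the ring of
  integer polynomials in all indeterminates.
\<close>

section \<open>Determinants and block matrices\<close>

lemma (in comm_monoid_set) atLeastLessThan_mult_group: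
  "F g {0..<m * n} = F (\<lambda>i. F (\<lambda>j. g (i * n + j)) {..<n}) {..<m::nat}"
proof -
  have "F g {0..<m * n} = F (\<lambda>i. F g {i * n..<i * n + n}) {..<m}"
    using nat_group[of g n m] by (simp add: lessThan_atLeast0)
  also have "\<dots> = F (\<lambda>i. F (\<lambda>j. g (i * n + j)) {..<n}) {..<m}"
  proof (rule cong)
    fix i
    show "F g {i * n..<i * n + n} = F (\<lambda>j. g (i * n + j)) {..<n}"
      using shift_bounds_nat_ivl[of g 0 "i * n" n]
      by (simp add: lessThan_atLeast0 add.commute)
  qed simp
  finally show ?thesis .
qed

text \<open>Rests on m^2 = 1 + (m + 1)(m - 1): index 0 is the extra first row, the others form m + 1
  block rows of height m - 1.\<close>

lemma (in comm_monoid_set) square_group: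
  assumes "m \<ge> 1"
  shows "F g {0..<m * m} = g 0 \<^bold>* F (\<lambda>i. F (\<lambda>j. g (Suc (i * (m - 1) + j))) {..<m - 1}) {..m::nat}"
proof -
  have sq: "m * m = Suc (Suc m * (m - 1))" using assms by (cases m) auto
  have "F g {0..<m * m} = g 0 \<^bold>* F g {Suc 0..<m * m}"
    using assms by (simp add: atLeast_Suc_lessThan)
  also have "F g {Suc 0..<m * m} = F (\<lambda>r. g (Suc r)) {0..<Suc m * (m - 1)}"
    unfolding sq by (rule shift_bounds_Suc_ivl)
  also have "\<dots> = F (\<lambda>i. F (\<lambda>j. g (Suc (i * (m - 1) + j))) {..<m - 1}) {..m}"
    by (simp only: atLeastLessThan_mult_group lessThan_Suc_atMost)
  finally show ?thesis .
qed

text \<open>If another permutation contributed to the Leibniz expansion, the sum of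
  \<open>rank\<close> along it would be strictly smaller than along \<open>p\<close>. Both sums run
  over all columns, so they are equal.\<close>

lemma det_ranked_permutation:
  fixes A :: "'a :: comm_ring_1 mat" and rank :: "nat \<Rightarrow> nat"
  assumes A: "A \<in> carrier_mat n n" and p: "p permutes {0..<n}"
    and tri: "\<And>i j. i < n \<Longrightarrow> j < n \<Longrightarrow> A $$ (i, j) \<noteq> 0 \<Longrightarrow> j = p i \<or> rank j < rank (p i)"
  shows "det A = signof p * (\<Prod>i = 0..<n. A $$ (i, p i))"
proof -
  have zero: "signof \<sigma> * (\<Prod>i = 0..<n. A $$ (i, \<sigma> i)) = 0"
    if \<sigma>: "\<sigma> permutes {0..<n}" and ne: "\<sigma> \<noteq> p" for \<sigma>
  proof (rule ccontr)
    assume nz: "\<not> ?thesis"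
    have nz': "A $$ (i, \<sigma> i) \<noteq> 0" if "i < n" for i
    proof
      assume "A $$ (i, \<sigma> i) = 0"
      hence "(\<Prod>i = 0..<n. A $$ (i, \<sigma> i)) = 0" using that by (intro prod_zero) auto
      with nz show False by simp
    qed
    have lt: "\<sigma> i < n" if "i < n" for i using \<sigma> that permutes_in_image[OF \<sigma>, of i] by auto
    obtain i where i: "\<sigma> i \<noteq> p i" using ne by blast
    hence "i < n" using \<sigma> p by (metis atLeastLessThan_iff le0 permutes_not_in)
    have "(\<Sum>i = 0..<n. rank (\<sigma> i)) < (\<Sum>i = 0..<n. rank (p i))"
    proof (rule sum_strict_mono_ex1)
      show "\<forall>i\<in>{0..<n}. rank (\<sigma> i) \<le> rank (p i)"
        using tri[OF _ lt nz'] by fastforce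
      show "\<exists>i\<in>{0..<n}. rank (\<sigma> i) < rank (p i)"
        using tri[OF \<open>i < n\<close> lt nz'] \<open>i < n\<close> i by auto
    qed simp
    thus False
      using sum.permute[OF \<sigma>, of rank] sum.permute[OF p, of rank] by (simp add: comp_def)
  qed
  have "det A = (\<Sum>\<sigma>\<in>{p}. signof \<sigma> * (\<Prod>i = 0..<n. A $$ (i, \<sigma> i)))"
    unfolding det_def'[OF A]
    by (rule sum.mono_neutral_right) (use p zero in \<open>auto simp: finite_permutations\<close>)
  thus ?thesis by simp
qed

text \<open>Row 0 applies \<open>\<phi>\<close> to the last block vector; row \<open>1 + R (m - 1) + (t - 1)\<close> is row \<open>R\<close> of
  \<open>4 (a_t E - y_t D) v_t - (b_t E - y_t D) v_{t+1}\<close>. The pencil matrices \<open>E\<close>, \<open>D\<close> have format \<open>(m+1) \<times> m\<close>.\<close>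

definition pencil_mat ::
  "nat \<Rightarrow> (nat \<Rightarrow> 'a) \<Rightarrow> (nat \<Rightarrow> 'a) \<Rightarrow> (nat \<Rightarrow> 'a) \<Rightarrow> (nat \<Rightarrow> nat \<Rightarrow> 'a) \<Rightarrow> (nat \<Rightarrow> nat \<Rightarrow> 'a) \<Rightarrow>
   (nat \<Rightarrow> 'a) \<Rightarrow> 'a :: comm_ring_1 mat" where
  "pencil_mat m a b y E D \<phi> = mat (m * m) (m * m) (\<lambda>(r, c).
     let C = c div m; s = c mod m + 1 in
     if r = 0 then (if s = m then \<phi> C else 0)
     else let R = (r - 1) div (m - 1); t = (r - 1) mod (m - 1) + 1 in
       if s = t then 4 * (a t * E R C - y t * D R C)
       else if s = t + 1 then - (b t * E R C - y t * D R C) else 0)"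

text \<open>This is the Kronecker product of U with the identity of size m: U acts on the block
  index and fixes the position inside the block. Likewise \<open>row_kron\<close> is the direct sum
  of 1 and the Kronecker product of W with the identity of size m - 1.\<close>

definition col_kron :: "nat \<Rightarrow> (nat \<Rightarrow> nat \<Rightarrow> 'a) \<Rightarrow> 'a :: comm_ring_1 mat" where
  "col_kron m U = mat (m * m) (m * m) (\<lambda>(c, c').
     if c mod m = c' mod m then U (c div m) (c' div m) else 0)"

definition row_kron :: "nat \<Rightarrow> (nat \<Rightarrow> nat \<Rightarrow> 'a) \<Rightarrow> 'a :: comm_ring_1 mat" where
  "row_kron m W = mat (m * m) (m * m) (\<lambda>(r, r').
     if r = 0 \<or> r' = 0 then (if r = r' then 1 else 0)
     else if (r - 1) mod (m - 1) = (r' - 1) mod (m - 1)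
     then W ((r - 1) div (m - 1)) ((r' - 1) div (m - 1)) else 0)"

lemma pencil_mat_carrier [simp]: "pencil_mat m a b y E D \<phi> \<in> carrier_mat (m * m) (m * m)"
  and col_kron_carrier [simp]: "col_kron m U \<in> carrier_mat (m * m) (m * m)"
  and row_kron_carrier [simp]: "row_kron m W \<in> carrier_mat (m * m) (m * m)"
  by (simp_all add: pencil_mat_def col_kron_def row_kron_def)

lemma pencil_mat_dim [simp]:
  "dim_row (pencil_mat m a b y E D \<phi>) = m * m" "dim_col (pencil_mat m a b y E D \<phi>) = m * m"
  "dim_row (col_kron m U) = m * m" "dim_col (col_kron m U) = m * m"
  "dim_row (row_kron m W) = m * m" "dim_col (row_kron m W) = m * m"
  by (simp_all add: pencil_mat_def col_kron_def row_kron_def)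

lemma col_index_less: "C < m \<Longrightarrow> s < m \<Longrightarrow> C * m + s < m * (m::nat)"
proof -
  assume "C < m" "s < m"
  have "C * m + s < Suc C * m" using \<open>s < m\<close> by simp
  also have "\<dots> \<le> m * m" using \<open>C < m\<close> by (intro mult_le_mono1) simp
  finally show ?thesis .
qed

lemma row_index_less: "R \<le> m \<Longrightarrow> t < m - 1 \<Longrightarrow> Suc (R * (m - 1) + t) < m * (m::nat)"
proof -
  assume "R \<le> m" "t < m - 1"
  hence sq: "m * m = Suc (Suc m * (m - 1))" by (cases m) auto
  have "R * (m - 1) + t < Suc R * (m - 1)" using \<open>t < m - 1\<close> by simp
  also have "\<dots> \<le> Suc m * (m - 1)" using \<open>R \<le> m\<close> by (intro mult_le_mono1) simp
  finally show ?thesis using sq by simp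
qed

lemma col_indexE:
  assumes "c < m * (m::nat)"
  obtains C s where "C < m" "s < m" "c = C * m + s"
proof
  have "m > 0" using assms by (cases m) auto
  thus "c div m < m" "c mod m < m" "c = c div m * m + c mod m"
    using assms by (auto simp: less_mult_imp_div_less)
qed

lemma row_indexE:
  assumes "r < m * (m::nat)" "m \<ge> 2"
  obtains "r = 0" | R t where "R \<le> m" "t < m - 1" "r = Suc (R * (m - 1) + t)"
proof (cases "r = 0")
  case False
  have sq: "m * m = Suc (Suc m * (m - 1))" using assms by (cases m) auto
  have "(r - 1) div (m - 1) < Suc m"
    using assms False sq by (intro less_mult_imp_div_less) auto
  moreover have "(r - 1) mod (m - 1) < m - 1" using assms by simp
  moreover have "r = Suc ((r - 1) div (m - 1) * (m - 1) + (r - 1) mod (m - 1))"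
    using False div_mult_mod_eq[of "r - 1" "m - 1"] by linarith
  ultimately show thesis using that(2) by (metis less_Suc_eq_le)
qed (use that in blast)

lemma pencil_mat_0:
  assumes "C < m" "s < m"
  shows "pencil_mat m a b y E D \<phi> $$ (0, C * m + s) = (if Suc s = m then \<phi> C else 0)"
  using assms col_index_less[OF assms] by (simp add: pencil_mat_def)

lemma pencil_mat_Suc:
  assumes "C < m" "s < m" "R \<le> m" "t < m - 1"
  shows "pencil_mat m a b y E D \<phi> $$ (Suc (R * (m - 1) + t), C * m + s) =
    (if s = t then 4 * (a (Suc t) * E R C - y (Suc t) * D R C)
     else if s = Suc t then - (b (Suc t) * E R C - y (Suc t) * D R C) else 0)"
proof -
  have "(R * (m - 1) + t) div (m - 1) = R" "(R * (m - 1) + t) mod (m - 1) = t"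
    using assms by auto
  thus ?thesis
    using assms col_index_less[OF assms(1,2)] row_index_less[OF assms(3,4)]
    by (simp add: pencil_mat_def)
qed

lemma col_kron_index:
  assumes "C < m" "s < m" "C' < m" "s' < m"
  shows "col_kron m U $$ (C * m + s, C' * m + s') = (if s = s' then U C C' else 0)"
  using assms by (simp add: col_kron_def col_index_less)

lemma row_kron_0: "r < m * m \<Longrightarrow> row_kron m W $$ (0, r) = (if r = 0 then 1 else 0)"
  by (cases "m = 0") (auto simp: row_kron_def)

lemma row_kron_Suc_0: "Suc r < m * m \<Longrightarrow> row_kron m W $$ (Suc r, 0) = 0"
  by (cases "m = 0") (auto simp: row_kron_def)

lemma row_kron_Suc:
  assumes "R \<le> m" "t < m - 1" "R' \<le> m" "t' < m - 1"
  shows "row_kron m W $$ (Suc (R * (m - 1) + t), Suc (R' * (m - 1) + t')) =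
    (if t = t' then W R R' else 0)"
proof -
  have "(R * (m - 1) + t) div (m - 1) = R" "(R * (m - 1) + t) mod (m - 1) = t"
       "(R' * (m - 1) + t') div (m - 1) = R'" "(R' * (m - 1) + t') mod (m - 1) = t'"
    using assms by auto
  thus ?thesis using row_index_less[OF assms(1,2)] row_index_less[OF assms(3,4)]
    by (auto simp: row_kron_def)
qed

text \<open>The base changes touch only block indices, while \<open>a\<close>, \<open>b\<close>,
  \<open>y\<close> depend only on the position inside a block. Hence the relations E U = W E' and D
  U = W D' carry over to the whole matrix.\<close>

lemma pencil_mat_change_basis:
  assumes m: "m \<ge> 2"
    and E: "\<And>R C'. R \<le> m \<Longrightarrow> C' < m \<Longrightarrow> (\<Sum>C<m. E R C * U C C') = (\<Sum>R'\<le>m. W R R' * E' R' C')"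
    and D: "\<And>R C'. R \<le> m \<Longrightarrow> C' < m \<Longrightarrow> (\<Sum>C<m. D R C * U C C') = (\<Sum>R'\<le>m. W R R' * D' R' C')"
    and \<phi>: "\<And>C'. C' < m \<Longrightarrow> (\<Sum>C<m. \<phi> C * U C C') = \<phi>' C'"
  shows "pencil_mat m a b y E D \<phi> * col_kron m U = row_kron m W * pencil_mat m a b y E' D' \<phi>'"
proof (rule eq_matI)
  fix r c' assume rc: "r < dim_row (row_kron m W * pencil_mat m a b y E' D' \<phi>')"
    "c' < dim_col (row_kron m W * pencil_mat m a b y E' D' \<phi>')"
  hence r: "r < m * m" and "c' < m * m" by auto
  then obtain C' s' where C': "C' < m" "s' < m" "c' = C' * m + s'" by (metis col_indexE)
  let ?M = "pencil_mat m a b y E D \<phi>" and ?M' = "pencil_mat m a b y E' D' \<phi>'"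
  have "(?M * col_kron m U) $$ (r, c') = (\<Sum>c = 0..<m * m. ?M $$ (r, c) * col_kron m U $$ (c, c'))"
    using r \<open>c' < m * m\<close> by (simp add: scalar_prod_def)
  also have "\<dots> = (\<Sum>C<m. \<Sum>s<m. if s = s' then ?M $$ (r, C * m + s) * U C C' else 0)"
    unfolding sum.atLeastLessThan_mult_group
    by (intro sum.cong refl) (use C' in \<open>auto simp: col_kron_index\<close>)
  also have "\<dots> = (\<Sum>C<m. ?M $$ (r, C * m + s') * U C C')"
    using C' by simp
  finally have L: "(?M * col_kron m U) $$ (r, c') = (\<Sum>C<m. ?M $$ (r, C * m + s') * U C C')" .
  have R: "(row_kron m W * ?M') $$ (r, c') = row_kron m W $$ (r, 0) * ?M' $$ (0, c')
      + (\<Sum>R\<le>m. \<Sum>t<m - 1. row_kron m W $$ (r, Suc (R * (m - 1) + t)) * ?M' $$ (Suc (R * (m - 1) + t), c'))"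
  proof -
    have "(row_kron m W * ?M') $$ (r, c') = (\<Sum>r' = 0..<m * m. row_kron m W $$ (r, r') * ?M' $$ (r', c'))"
      using r \<open>c' < m * m\<close> by (simp add: scalar_prod_def)
    thus ?thesis using m by (simp add: sum.square_group)
  qed
  from r m show "(?M * col_kron m U) $$ (r, c') = (row_kron m W * ?M') $$ (r, c')"
  proof (cases rule: row_indexE)
    case 1
    have "(\<Sum>R\<le>m. \<Sum>t<m - 1. row_kron m W $$ (r, Suc (R * (m - 1) + t)) * ?M' $$ (Suc (R * (m - 1) + t), c')) = 0"
      using 1 by (intro sum.neutral ballI) (auto simp: row_kron_0[OF row_index_less] simp del: One_nat_def)
    moreover have "(\<Sum>C<m. ?M $$ (r, C * m + s') * U C C') = ?M' $$ (0, c')"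
      using C' 1 by (simp add: pencil_mat_0 \<phi>)
    ultimately show ?thesis unfolding L R using 1 r by (simp add: row_kron_0)
  next
    case (2 R t)
    have "(\<Sum>R'\<le>m. \<Sum>t'<m - 1. row_kron m W $$ (r, Suc (R' * (m - 1) + t')) * ?M' $$ (Suc (R' * (m - 1) + t'), c'))
      = (\<Sum>R'\<le>m. \<Sum>t'<m - 1. if t' = t then W R R' * ?M' $$ (Suc (R' * (m - 1) + t'), c') else 0)"
      using 2 by (intro sum.cong refl) (auto simp: row_kron_Suc simp del: One_nat_def)
    also have "\<dots> = (\<Sum>R'\<le>m. W R R' * ?M' $$ (Suc (R' * (m - 1) + t), c'))"
      using 2 by simp
    also have "\<dots> = (\<Sum>C<m. ?M $$ (r, C * m + s') * U C C')"
    proof -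
      let ?e = "\<Sum>R'\<le>m. W R R' * E' R' C'" and ?d = "\<Sum>R'\<le>m. W R R' * D' R' C'"
      have e: "?e = (\<Sum>C<m. E R C * U C C')" and d: "?d = (\<Sum>C<m. D R C * U C C')"
        using E D C' 2 by auto
      have *: "(\<Sum>R'\<le>m. W R R' * (x * E' R' C' - z * D' R' C')) =
        (\<Sum>C<m. (x * E R C - z * D R C) * U C C')" for x z
      proof -
        have "(\<Sum>R'\<le>m. W R R' * (x * E' R' C' - z * D' R' C')) = x * ?e - z * ?d"
          by (simp add: algebra_simps sum_subtractf sum_distrib_left)
        also have "\<dots> = (\<Sum>C<m. (x * E R C - z * D R C) * U C C')"
          unfolding e d by (simp add: algebra_simps sum_subtractf sum_distrib_left)
        finally show ?thesis .
      qed
      consider "s' = t" | "s' = Suc t" | "s' \<noteq> t" "s' \<noteq> Suc t" by blast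
      thus ?thesis
      proof cases
        case 1
        have "(\<Sum>R'\<le>m. W R R' * (4 * f R')) = 4 * (\<Sum>R'\<le>m. W R R' * f R')"
             "(\<Sum>C<m. 4 * f C * U C C') = 4 * (\<Sum>C<m. f C * U C C')" for f
          by (simp_all add: sum_distrib_left mult_ac)
        thus ?thesis using C' 1 2 *[of "a (Suc t)" "y (Suc t)"]
          by (simp add: pencil_mat_Suc del: One_nat_def right_diff_distrib_numeral)
      next
        case c2: 2
        thus ?thesis using C' 2 *[of "b (Suc t)" "y (Suc t)"]
          by (simp add: pencil_mat_Suc sum_negf del: minus_diff_eq One_nat_def add_Suc_right)
      next
        case 3
        thus ?thesis using C' 2 by (simp add: pencil_mat_Suc del: One_nat_def)
      qed
    qed
    finally show ?thesis unfolding L R using 2 r by (simp add: row_kron_Suc_0)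
  qed
qed auto

definition triangular :: "nat \<Rightarrow> (nat \<Rightarrow> nat \<Rightarrow> 'a :: zero) \<Rightarrow> bool" where
  "triangular n U \<longleftrightarrow> (\<forall>i j. i < j \<longrightarrow> j < n \<longrightarrow> U i j = 0) \<or> (\<forall>i j. j < i \<longrightarrow> i < n \<longrightarrow> U i j = 0)"

lemma det_triangular:
  assumes "A \<in> carrier_mat n n" "triangular n (\<lambda>i j. A $$ (i, j))"
  shows "det A = (\<Prod>i = 0..<n. A $$ (i, i))"
proof -
  have "det A = prod_list (diag_mat A)"
    using assms(2) unfolding triangular_def
  proof
    assume "\<forall>i j. i < j \<longrightarrow> j < n \<longrightarrow> A $$ (i, j) = 0"
    thus ?thesis using assms(1) by (intro det_lower_triangular) auto
  next
    assume "\<forall>i j. j < i \<longrightarrow> i < n \<longrightarrow> A $$ (i, j) = 0"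
    thus ?thesis using assms(1) by (intro det_upper_triangular upper_triangularI) auto
  qed
  thus ?thesis using assms(1) by (simp add: prod_list_diag_prod)
qed

lemma less_same_mod_imp_div_less: "i < j \<Longrightarrow> i mod n = j mod n \<Longrightarrow> i div n < j div (n::nat)"
  by (metis div_le_mono div_mult_mod_eq le_neq_implies_less less_imp_le_nat less_not_refl)

text \<open>Within one residue class mod m, the order of indices is the order of their quotients, so
  the Kronecker product inherits triangularity from U.\<close>

lemma det_col_kron:
  assumes "triangular m U"
  shows "det (col_kron m U) = (\<Prod>C<m. U C C ^ m)"
proof -
  have less: "i div m < m" if "i < m * m" for i
    using that by (simp add: less_mult_imp_div_less)
  have "triangular (m * m) (\<lambda>i j. col_kron m U $$ (i, j))"
    using assms unfolding triangular_def
    by (auto simp: col_kron_def less less_same_mod_imp_div_less dest: less_same_mod_imp_div_less[OF _ sym])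
  hence "det (col_kron m U) = (\<Prod>C<m. \<Prod>s<m. col_kron m U $$ (C * m + s, C * m + s))"
    by (simp add: det_triangular[OF col_kron_carrier] prod.atLeastLessThan_mult_group)
  thus ?thesis by (simp add: col_kron_index)
qed

lemma det_row_kron:
  assumes "triangular (Suc m) W" and m: "m \<ge> 2"
  shows "det (row_kron m W) = (\<Prod>R\<le>m. W R R ^ (m - 1))"
proof -
  have sq: "m * m = Suc (Suc m * (m - 1))" using m by (cases m) auto
  have less: "(i - 1) div (m - 1) < Suc m" if "i < m * m" "i > 0" for i
    using that sq by (intro less_mult_imp_div_less) auto
  have less': "(i - 1) div (m - 1) < (j - 1) div (m - 1)"
    if "i < j" "i > 0" "(i - 1) mod (m - 1) = (j - 1) mod (m - 1)" for i j
    using that by (intro less_same_mod_imp_div_less) auto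
  have "triangular (m * m) (\<lambda>i j. row_kron m W $$ (i, j))"
    using assms(1) unfolding triangular_def
  proof (elim disj_forward)
    assume W: "\<forall>i j. i < j \<longrightarrow> j < Suc m \<longrightarrow> W i j = 0"
    show "\<forall>i j. i < j \<longrightarrow> j < m * m \<longrightarrow> row_kron m W $$ (i, j) = 0"
      by (auto simp: row_kron_def less less' W simp del: One_nat_def)
  next
    assume W: "\<forall>i j. j < i \<longrightarrow> i < Suc m \<longrightarrow> W i j = 0"
    show "\<forall>i j. j < i \<longrightarrow> i < m * m \<longrightarrow> row_kron m W $$ (i, j) = 0"
      by (auto simp: row_kron_def less less' W simp del: One_nat_def)
  qed
  hence "det (row_kron m W) = (\<Prod>R\<le>m. \<Prod>t<m - 1. row_kron m W $$ (Suc (R * (m - 1) + t), Suc (R * (m - 1) + t)))"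
    using m by (simp add: det_triangular[OF row_kron_carrier] prod.square_group row_kron_0)
  also have "\<dots> = (\<Prod>R\<le>m. \<Prod>t<m - 1. W R R)"
    by (intro prod.cong refl) (simp add: row_kron_Suc del: One_nat_def)
  finally show ?thesis by simp
qed

section \<open>The determinant in the Newton basis\<close>

text \<open>\<open>matching m\<close> sends row \<open>(R, t)\<close> to column \<open>(R - 1, t + 1)\<close> if \<open>R + t > m\<close> and to column \<open>(R, t)\<close>
  otherwise (with \<open>t \<ge> 1\<close>), and row 0 to column \<open>(0, m)\<close>. Up to one transposition it rotates each
  block of \<open>m - 1\<close> rows, which makes its sign computable.\<close>

definition rot :: "nat \<Rightarrow> nat \<Rightarrow> nat" where
  "rot m r = (if r = 0 \<or> m * m \<le> r then r
     else Suc ((r - 1) div (m - 1) * (m - 1) +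
       ((r - 1) mod (m - 1) + ((r - 1) div (m - 1) + (m - 2))) mod (m - 1)))"

definition matching :: "nat \<Rightarrow> nat \<Rightarrow> nat" where
  "matching m = transpose 0 (m - 1) \<circ> rot m"

lemma rot_Suc:
  assumes "R \<le> m" "t < m - 1"
  shows "rot m (Suc (R * (m - 1) + t)) = Suc (R * (m - 1) + (t + (R + (m - 2))) mod (m - 1))"
proof -
  have "(R * (m - 1) + t) div (m - 1) = R" "(R * (m - 1) + t) mod (m - 1) = t"
    using assms by auto
  thus ?thesis using row_index_less[OF assms] unfolding rot_def by (simp del: One_nat_def)
qed

lemma rot_funpow_Suc:
  assumes "R \<le> m" "t < m - 1"
  shows "(rot m ^^ n) (Suc (R * (m - 1) + t)) = Suc (R * (m - 1) + (t + n * (R + (m - 2))) mod (m - 1))"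
proof (induction n)
  case (Suc n)
  let ?d = "R + (m - 2)"
  have "(rot m ^^ Suc n) (Suc (R * (m - 1) + t)) = rot m (Suc (R * (m - 1) + (t + n * ?d) mod (m - 1)))"
    by (simp only: funpow.simps(2) comp_apply Suc)
  also have "\<dots> = Suc (R * (m - 1) + ((t + n * ?d) mod (m - 1) + ?d) mod (m - 1))"
    using assms by (intro rot_Suc) auto
  also have "((t + n * ?d) mod (m - 1) + ?d) mod (m - 1) = (t + Suc n * ?d) mod (m - 1)"
  proof -
    have "((t + n * d) mod k + d) mod k = (t + Suc n * d) mod k" for d k
      by (simp add: mod_add_right_eq algebra_simps)
    thus ?thesis .
  qed
  finally show ?case .
qed (use assms in simp)

text \<open>On each block \<open>rot\<close> is a fixed cyclic shift of m - 1 places. Both its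
  bijectivity and its sign are read off from this.\<close>

lemma rot_funpow_id:
  assumes "m \<ge> 2"
  shows "rot m ^^ (m - 1) = id"
proof
  fix r
  show "(rot m ^^ (m - 1)) r = id r"
  proof (cases "r < m * m")
    case True
    from this assms show ?thesis
    proof (cases rule: row_indexE)
      case 1
      have "(rot m ^^ n) 0 = 0" for n by (induction n) (auto simp: rot_def)
      thus ?thesis using 1 by simp
    next
      case (2 R t)
      thus ?thesis by (simp add: rot_funpow_Suc del: One_nat_def)
    qed
  next
    case False
    hence "(rot m ^^ n) r = r" for n by (induction n) (auto simp: rot_def)
    thus ?thesis by simp
  qed
qed

lemma rot_permutes:
  assumes "m \<ge> 2"
  shows "rot m permutes {0..<m * m}"
proof (rule bij_imp_permutes)
  \<comment> \<open>The inverse of \<open>rot m\<close> is its power with exponent m - 2.\<close>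
  have "Suc (m - 2) = m - 1" using assms by simp
  hence "rot m \<circ> rot m ^^ (m - 2) = id" "rot m ^^ (m - 2) \<circ> rot m = id"
    using rot_funpow_id[OF assms] funpow.simps(2)[of "m - 2" "rot m"] funpow_Suc_right[of "m - 2" "rot m"]
    by metis+
  hence "bij (rot m)" by (metis o_bij)
  have inv: "rot m r < m * m" if "r < m * m" for r
    using that assms
  proof (cases rule: row_indexE)
    case (2 R t)
    thus ?thesis using assms by (simp add: rot_Suc row_index_less del: One_nat_def)
  qed (use that in \<open>simp add: rot_def\<close>)
  show "bij_betw (rot m) {0..<m * m} {0..<m * m}"
  proof -
    have "inj_on (rot m) {0..<m * m}" using \<open>bij (rot m)\<close> by (meson bij_def inj_on_subset subset_UNIV)
    moreover have "rot m ` {0..<m * m} \<subseteq> {0..<m * m}" using inv by auto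
    ultimately show ?thesis by (simp add: bij_betw_def endo_inj_surj)
  qed
qed (auto simp: rot_def)

lemma sign_funpow: "permutation p \<Longrightarrow> sign (p ^^ n) = sign p ^ n"
proof (induction n)
  case (Suc n)
  have "permutation (p ^^ n)"
    using Suc.prems by (induction n) (auto intro: permutation_compose simp: permutation_id)
  thus ?case using Suc by (simp only: funpow.simps(2) sign_compose power_Suc)
qed simp

text \<open>The order of this permutation divides the odd number \<open>m - 1\<close>, so it is even.\<close>

lemma sign_rot:
  assumes "m \<ge> 2" "even m"
  shows "sign (rot m) = 1"
proof -
  have "permutation (rot m)"
    using rot_permutes[OF assms(1)] by (rule permutes_imp_permutation[rotated]) simp
  hence "sign (rot m) ^ (m - 1) = 1"
    using rot_funpow_id[OF assms(1)] by (metis sign_funpow sign_id)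
  thus ?thesis using assms by (cases "rot m" rule: sign_cases) auto
qed

lemma matching_permutes:
  assumes "m \<ge> 2"
  shows "matching m permutes {0..<m * m}"
  unfolding matching_def
proof (rule permutes_compose[OF rot_permutes[OF assms]])
  have "m - 1 < m * m" using assms by (cases m) auto
  thus "transpose 0 (m - 1) permutes {0..<m * m}"
    using assms by (intro permutes_swap_id) auto
qed

lemma sign_matching:
  assumes "m \<ge> 2" "even m"
  shows "sign (matching m) = -1"
proof -
  have "permutation (rot m)"
    using rot_permutes[OF assms(1)] by (rule permutes_imp_permutation[rotated]) simp
  thus ?thesis using assms unfolding matching_def
    by (subst sign_compose) (auto simp: sign_rot sign_swap_id permutation_swap_id)
qed

lemma matching_0: "matching m 0 = m - 1"
  by (simp add: matching_def rot_def)

text \<open>Counted from 0, column (R, t) has number 1 + R (m - 1) + (R + t - 1): row (R, t) is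
  shifted by R - 1 inside its block, and a wrap-around lands on (R - 1, t + 1). The shift is written
  \<open>R + (m - 2)\<close>, congruent to R - 1 mod m - 1, to avoid truncation at R = 0.\<close>

lemma matching_Suc:
  assumes "R \<le> m" "t < m - 1"
  shows "matching m (Suc (R * (m - 1) + t)) = (if m \<le> R + t then (R - 1) * m + Suc t else R * m + t)"
proof -
  obtain n where m: "m = Suc (Suc n)" using assms(2) by (cases m; cases "m - 1") auto
  have rot: "rot m (Suc (R * (m - 1) + t)) = Suc (R * (m - 1) + (t + (R + (m - 2))) mod (m - 1))"
    by (rule rot_Suc[OF assms])
  \<comment> \<open>Only case (b) meets the transposition: there the shift yields m - 1, which is
    exchanged with 0.\<close>
  consider (a) "m \<le> R + t" | (b) "R = 0" "t = 0" | (c) "R = 0" "t > 0" | (d) "R > 0" "R + t < m" by linarith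
  thus ?thesis
  proof cases
    case a
    have "t + (R + (m - 2)) = (R + t - m) + 2 * (m - 1)" using a m by simp
    hence "(t + (R + (m - 2))) mod (m - 1) = R + t - m"
      using assms a by (simp only: mod_mult_self1 mod_less)
    moreover obtain Q where "R = Suc Q" using a assms by (cases R) auto
    ultimately show ?thesis using rot a m unfolding matching_def by (auto simp: transpose_def algebra_simps)
  next
    case b
    thus ?thesis using rot m unfolding matching_def by simp
  next
    case c
    have "t + (R + (m - 2)) = (t - 1) + (m - 1)" using c m by simp
    hence "(t + (R + (m - 2))) mod (m - 1) = t - 1" using assms by (metis mod_add_self2 mod_less less_imp_diff_less)
    thus ?thesis using rot c m assms unfolding matching_def by (simp add: transpose_def)
  next
    case d
    have "t + (R + (m - 2)) = (R + t - 1) + (m - 1)" using d m by simp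
    moreover have "R + t - 1 < m - 1" using d by simp
    ultimately have "(t + (R + (m - 2))) mod (m - 1) = R + t - 1" by (metis mod_add_self2 mod_less)
    moreover obtain Q where "R = Suc Q" using d by (cases R) auto
    ultimately show ?thesis using rot d m unfolding matching_def by (auto simp: transpose_def algebra_simps)
  qed
qed

section \<open>The Leibniz expansion of the Newton pencil\<close>

definition newton_E :: "nat \<Rightarrow> nat \<Rightarrow> 'a :: comm_ring_1" where
  "newton_E R C = (if R = Suc C then 1 else 0)"

text \<open>Let column C stand for w_C and row R for s_R. Then E w_C = s_{C+1} and (c_C E - D) w_C =
  s_C, so with D as multiplication by x and E as inclusion, s_C = (c_C - x) s_{C+1}.\<close>

definition newton_D :: "(nat \<Rightarrow> 'a) \<Rightarrow> nat \<Rightarrow> nat \<Rightarrow> 'a :: comm_ring_1" where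
  "newton_D c R C = (if R = Suc C then c C else if R = C then -1 else 0)"

text \<open>With the nodes in reversed order, c_C = \<alpha>(m - C), the coefficient of s_{C+1} in
  (\<alpha>_t E - D) w_C vanishes for C = m - t. These zeros leave \<open>matching m\<close> as the
  only permutation. It pairs row 0 with block column 0, whence the factor
  \<open>\<phi> 0\<close>.\<close>

lemma det_newton_pencil:
  assumes m: "m \<ge> 2" "even m" and a: "\<And>t. a t = y t * \<alpha> t"
  shows "det (pencil_mat m a b y newton_E (newton_D (\<lambda>C. \<alpha> (m - C))) \<phi>) =
    - \<phi> 0 * (\<Prod>R\<le>m. \<Prod>t<m - 1.
      if m \<le> R + t then - (b (Suc t) - y (Suc t) * \<alpha> (Suc m - R)) else 4 * y (Suc t))"
proof -
  let ?A = "pencil_mat m a b y newton_E (newton_D (\<lambda>C. \<alpha> (m - C))) \<phi>"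
  \<comment> \<open>Columns with C + s \<ge> m get ranks at most 2m - 1, the others ranks at least
    3m + 1. The rank increases with s and decreases with C in the first group, and conversely in the
    second.\<close>
  define rank where "rank c = (let C = c div m; s = c mod m in if m \<le> C + s then Suc s + m - C else 4 * m + C - s)" for c
  have rank: "rank (C * m + s) = (if m \<le> C + s then Suc s + m - C else 4 * m + C - s)" if "s < m" for C s
    using that by (simp add: rank_def)
  have "det ?A = signof (matching m) * (\<Prod>i = 0..<m * m. ?A $$ (i, matching m i))"
  proof (rule det_ranked_permutation[OF pencil_mat_carrier matching_permutes[OF m(1)], where rank = rank])
    fix i j assume i: "i < m * m" and j: "j < m * m" and nz: "?A $$ (i, j) \<noteq> 0"
    obtain C s where C: "C < m" "s < m" "j = C * m + s" using j by (metis col_indexE)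
    from i m(1) show "j = matching m i \<or> rank j < rank (matching m i)"
    proof (cases rule: row_indexE)
      case 1
      hence "Suc s = m" using nz C by (auto simp: pencil_mat_0 split: if_splits)
      moreover have "rank (m - 1) = 3 * m + 1" using m rank[of "m - 1" 0] by simp
      ultimately show ?thesis using 1 C by (cases "C = 0") (auto simp: matching_0 rank)
    next
      case (2 R t)
      note A = pencil_mat_Suc[OF C(1,2) 2(1,2), of a b y newton_E "newton_D (\<lambda>C. \<alpha> (m - C))" \<phi>]
      show ?thesis
      proof (cases "m \<le> R + t")
        case True
        hence R: "R \<ge> 1" using 2 by linarith
        have "matching m i = (R - 1) * m + Suc t" using True 2 by (simp add: matching_Suc del: One_nat_def)
        moreover have "rank ((R - 1) * m + Suc t) = Suc (Suc t) + m - (R - 1)"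
          using True 2 R by (subst rank) auto
        \<comment> \<open>On the boundary R + t = m, column (R - 1, t) has high rank, but its entry
          is a multiple of \<alpha>(t + 1) - \<alpha>(m - C) = 0.\<close>
        moreover have "s = t \<or> s = Suc t" "R = Suc C \<or> R = C" "\<not> (s = t \<and> R = Suc C \<and> m = C + Suc t)"
          using nz A 2 C a by (auto simp: newton_E_def newton_D_def split: if_splits)
        ultimately show ?thesis using C True R 2 by (auto simp: rank)
      next
        case False
        have "matching m i = R * m + t" using False 2 by (simp add: matching_Suc del: One_nat_def)
        moreover have "rank (R * m + t) = 4 * m + R - t"
          using False 2 by (subst rank) auto
        moreover have "s = t \<or> s = Suc t" "R = Suc C \<or> R = C"
          using nz A 2 C by (auto simp: newton_E_def newton_D_def split: if_splits)
        ultimately show ?thesis using C False 2 by (auto simp: rank)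
      qed
    qed
  qed
  also have "(\<Prod>i = 0..<m * m. ?A $$ (i, matching m i)) = \<phi> 0 * (\<Prod>R\<le>m. \<Prod>t<m - 1.
      if m \<le> R + t then - (b (Suc t) - y (Suc t) * \<alpha> (Suc m - R)) else 4 * y (Suc t))"
  proof -
    have "?A $$ (Suc (R * (m - 1) + t), matching m (Suc (R * (m - 1) + t))) =
      (if m \<le> R + t then - (b (Suc t) - y (Suc t) * \<alpha> (Suc m - R)) else 4 * y (Suc t))"
      if Rt: "R \<le> m" "t < m - 1" for R t
    proof (cases "m \<le> R + t")
      case True
      hence "R - 1 < m" "Suc t < m" "R = Suc (R - 1)" "m - (R - 1) = Suc m - R" using Rt by auto
      moreover have "matching m (Suc (R * (m - 1) + t)) = (R - 1) * m + Suc t"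
        using True Rt by (simp add: matching_Suc del: One_nat_def)
      ultimately show ?thesis using True Rt
        by (simp only: pencil_mat_Suc newton_E_def newton_D_def) simp
    next
      case False
      thus ?thesis using Rt
        by (simp add: pencil_mat_Suc matching_Suc newton_E_def newton_D_def del: One_nat_def)
    qed
    moreover have "?A $$ (0, matching m 0) = \<phi> 0"
      using m pencil_mat_0[of 0 m "m - 1"] by (simp add: matching_0)
    ultimately show ?thesis using m by (simp add: prod.square_group del: One_nat_def)
  qed
  finally show ?thesis using m by (simp add: sign_matching)
qed

section \<open>Change of basis\<close>

definition init_E :: "'a \<Rightarrow> nat \<Rightarrow> nat \<Rightarrow> 'a :: comm_ring_1" where
  "init_E q R C = (if R = C then q else if R = Suc C then -1 else 0)"

text \<open>The matrix of q N + m (q - z) z d/dz on powers of z, with N = m (m + 1);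
  \<open>init_E\<close> is multiplication by q - z.\<close>

definition init_D :: "nat \<Rightarrow> 'a \<Rightarrow> nat \<Rightarrow> nat \<Rightarrow> 'a :: comm_ring_1" where
  "init_D m q R C = (if R = C then q * of_nat (m * Suc m + m * R)
     else if R = Suc C then - of_nat (m * C) else 0)"

definition power_D :: "nat \<Rightarrow> 'a \<Rightarrow> nat \<Rightarrow> nat \<Rightarrow> 'a :: comm_ring_1" where
  "power_D m q R p = (if R = Suc p then of_nat (m * p)
     else if R = p then q * (of_nat (m * Suc m) - of_nat (m * p)) else 0)"

definition power_basis :: "'a \<Rightarrow> nat \<Rightarrow> nat \<Rightarrow> 'a :: comm_ring_1" where
  "power_basis q i p = coeff ([:q, -1:] ^ p) i"

lemma power_basis_eq: "power_basis q i p = of_nat (p choose i) * (- 1) ^ i * q ^ (p - i)"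
proof (cases "i \<le> p")
  case False
  have "degree ([:q, -1:] ^ p) \<le> p"
    using degree_power_le[of "[:q, -1:]" p] by (simp split: if_splits)
  thus ?thesis using False by (simp add: power_basis_def coeff_eq_0 binomial_eq_0)
qed (simp add: power_basis_def coeff_linear_poly_power)

lemma power_basis_eq_0: "p < i \<Longrightarrow> power_basis q i p = 0"
  by (simp add: power_basis_eq binomial_eq_0)

lemma power_basis_Suc:
  "power_basis q R (Suc p) = q * power_basis q R p - (if R = 0 then 0 else power_basis q (R - 1) p)"
  by (cases R) (simp_all add: power_basis_def)

text \<open>The sum stops at C = m - 1, whereas row R = m would also read \<open>f m\<close>. The
  condition \<open>f m = 0\<close> lets one formula serve all rows.\<close>

lemma sum_init_E:
  assumes "R \<le> m" "f m = 0"
  shows "(\<Sum>C<m. init_E q R C * f C) = q * f R - (if R = 0 then 0 else f (R - 1))"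
proof -
  have "(\<Sum>C<m. init_E q R C * f C) =
      (\<Sum>C<m. (if C = R then q * f C else 0) - (if C = R - 1 then if R = 0 then 0 else f C else 0))"
    by (intro sum.cong refl) (auto simp: init_E_def)
  also have "\<dots> = q * f R - (if R = 0 then 0 else f (R - 1))"
    using assms by (cases "R = m") (auto simp: sum_subtractf sum_negf)
  finally show ?thesis .
qed

lemma sum_init_D:
  assumes "R \<le> m" "f m = 0"
  shows "(\<Sum>C<m. init_D m q R C * f C) =
    q * of_nat (m * Suc m + m * R) * f R - (if R = 0 then 0 else of_nat (m * (R - 1)) * f (R - 1))"
proof -
  have "(\<Sum>C<m. init_D m q R C * f C) =
      (\<Sum>C<m. (if C = R then q * of_nat (m * Suc m + m * R) * f C else 0)
        - (if C = R - 1 then if R = 0 then 0 else of_nat (m * (R - 1)) * f C else 0))"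
    by (intro sum.cong refl) (auto simp: init_D_def)
  also have "\<dots> = q * of_nat (m * Suc m + m * R) * f R - (if R = 0 then 0 else of_nat (m * (R - 1)) * f (R - 1))"
    using assms by (cases "R = m") (auto simp: sum_subtractf sum_negf)
  finally show ?thesis .
qed

lemma sum_newton_E:
  assumes "p < m"
  shows "(\<Sum>R\<le>m. f R * newton_E R p) = f (Suc p)"
proof -
  have "(\<Sum>R\<le>m. f R * newton_E R p) = (\<Sum>R\<le>m. if R = Suc p then f R else 0)"
    by (intro sum.cong refl) (auto simp: newton_E_def)
  thus ?thesis using assms by simp
qed

lemma sum_newton_D:
  assumes "p < m"
  shows "(\<Sum>R\<le>m. f R * newton_D c R p) = c p * f (Suc p) - f p"
proof -
  have "(\<Sum>R\<le>m. f R * newton_D c R p) =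
      (\<Sum>R\<le>m. (if R = Suc p then c p * f R else 0) - (if R = p then f R else 0))"
    by (intro sum.cong refl) (auto simp: newton_D_def)
  thus ?thesis using assms by (simp add: sum_subtractf)
qed

lemma sum_power_D:
  assumes "p < m"
  shows "(\<Sum>R\<le>m. f R * power_D m q R p) =
    of_nat (m * p) * f (Suc p) + q * (of_nat (m * Suc m) - of_nat (m * p)) * f p"
proof -
  have "(\<Sum>R\<le>m. f R * power_D m q R p) =
      (\<Sum>R\<le>m. (if R = Suc p then of_nat (m * p) * f R else 0)
        + (if R = p then q * (of_nat (m * Suc m) - of_nat (m * p)) * f R else 0))"
    by (intro sum.cong refl) (auto simp: power_D_def)
  thus ?thesis using assms by (simp add: sum.distrib)
qed

lemma sum_power_D_row:
  assumes "R \<le> m" "f m = 0"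
  shows "(\<Sum>C<m. power_D m q R C * f C) = (if R = 0 then 0 else of_nat (m * (R - 1)) * f (R - 1))
    + q * (of_nat (m * Suc m) - of_nat (m * R)) * f R"
proof -
  have "(\<Sum>C<m. power_D m q R C * f C) =
      (\<Sum>C<m. (if C = R - 1 then if R = 0 then 0 else of_nat (m * (R - 1)) * f C else 0)
       + (if C = R then q * (of_nat (m * Suc m) - of_nat (m * R)) * f C else 0))"
    by (intro sum.cong refl) (auto simp: power_D_def)
  also have "\<dots> = (if R = 0 then 0 else of_nat (m * (R - 1)) * f (R - 1))
    + q * (of_nat (m * Suc m) - of_nat (m * R)) * f R"
    using assms by (cases "R = m") (auto simp: sum.distrib)
  finally show ?thesis .
qed

lemma sum_newton_E_row:
  assumes "R \<le> m"
  shows "(\<Sum>C<m. newton_E R C * f C) = (if R = 0 then 0 else f (R - 1))"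
proof -
  have "(\<Sum>C<m. newton_E R C * f C) = (\<Sum>C<m. if C = R - 1 then if R = 0 then 0 else f C else 0)"
    by (intro sum.cong refl) (auto simp: newton_E_def)
  thus ?thesis using assms by auto
qed

text \<open>With \<open>L = q - z\<close> and \<open>N = m (m + 1)\<close>, this is the coefficient form of
  \<open>q N P + m L z P' = m p L P + q (N - m p) P\<close> for \<open>P = L ^ p\<close>.\<close>

lemma power_basis_D:
  fixes q :: "'a :: idom"
  shows "q * of_nat (m * Suc m + m * R) * power_basis q R p
      - (if R = 0 then 0 else of_nat (m * (R - 1)) * power_basis q (R - 1) p)
    = of_nat (m * p) * power_basis q R (Suc p)
      + q * (of_nat (m * Suc m) - of_nat (m * p)) * power_basis q R p"
proof -
  let ?L = "[:q, -1:]"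
  have pd: "pCons 0 (pderiv (?L ^ p)) * ?L = - smult (of_nat p) (pCons 0 (?L ^ p))"
    by (cases p) (simp_all add: pderiv_power_Suc pderiv_pCons mult_ac del: power_Suc, simp_all add: mult_ac)
  have 1: "coeff (pCons 0 (pderiv (?L ^ p)) * ?L) R = q * (of_nat R * power_basis q R p)
      - (if R = 0 then 0 else of_nat (R - 1) * power_basis q (R - 1) p)"
    by (cases R; cases "R - 1") (simp_all add: power_basis_def coeff_pderiv mult.commute[of _ ?L])
  have 2: "coeff (- smult (of_nat p) (pCons 0 (?L ^ p))) R =
      - of_nat p * (if R = 0 then 0 else power_basis q (R - 1) p)"
    by (cases R) (simp_all add: power_basis_def)
  have "q * (of_nat R * power_basis q R p) - (if R = 0 then 0 else of_nat (R - 1) * power_basis q (R - 1) p)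
    = of_nat p * power_basis q R (Suc p) - q * of_nat p * power_basis q R p"
    using 1 2 pd by (simp add: power_basis_Suc algebra_simps)
  hence "of_nat m * (q * (of_nat R * power_basis q R p) - (if R = 0 then 0 else of_nat (R - 1) * power_basis q (R - 1) p))
    = of_nat m * (of_nat p * power_basis q R (Suc p) - q * of_nat p * power_basis q R p)"
    by simp
  thus ?thesis by (cases "R = 0") (simp_all add: algebra_simps)
qed

lemma det_init_pencil_eq_power:
  fixes q :: "'a :: idom"
  assumes m: "m \<ge> 2" "4 dvd m"
  shows "det (pencil_mat m a b y (init_E q) (init_D m q) \<phi>) =
    det (pencil_mat m a b y newton_E (power_D m q) (\<lambda>p. \<Sum>C<m. \<phi> C * power_basis q C p))"
proof -
  let ?M = "pencil_mat m a b y (init_E q) (init_D m q) \<phi>"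
  let ?M' = "pencil_mat m a b y newton_E (power_D m q) (\<lambda>p. \<Sum>C<m. \<phi> C * power_basis q C p)"
  have "?M * col_kron m (power_basis q) = row_kron m (power_basis q) * ?M'"
  proof (rule pencil_mat_change_basis[OF m(1)])
    fix R p assume R: "R \<le> m" and p: "p < m"
    have 0: "power_basis q m p = 0" using p by (rule power_basis_eq_0)
    show "(\<Sum>C<m. init_E q R C * power_basis q C p) = (\<Sum>R'\<le>m. power_basis q R R' * newton_E R' p)"
      by (simp only: sum_init_E[OF R, of "\<lambda>C. power_basis q C p", OF 0] sum_newton_E[OF p] power_basis_Suc)
    show "(\<Sum>C<m. init_D m q R C * power_basis q C p) = (\<Sum>R'\<le>m. power_basis q R R' * power_D m q R' p)"
      by (simp only: sum_init_D[OF R, of "\<lambda>C. power_basis q C p", OF 0] sum_power_D[OF p] power_basis_D)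
  qed simp
  hence "det (?M * col_kron m (power_basis q)) = det (row_kron m (power_basis q) * ?M')" by simp
  moreover have tri: "triangular n (power_basis q)" for n
    unfolding triangular_def by (simp add: power_basis_eq_0)
  \<comment> \<open>The sum equals m (m + 1) / 2. Since the diagonal entries of
    \<open>power_basis\<close> are (-1)^i, its parity decides the determinant of the row base
    change.\<close>
  have "even (\<Sum>{..m})"
    using m by (auto simp: atMost_atLeast0 gauss_sum_nat elim!: dvdE)
  hence "(\<Prod>R\<le>m. power_basis q R R ^ (m - 1)) = 1"
    by (simp add: power_basis_eq flip: prod_power_distrib power_sum)
  moreover have "even m" using m by (meson dvd_trans even_numeral)
  hence "(\<Prod>C<m. power_basis q C C ^ m) = 1"
    by (simp add: power_basis_eq power_even_eq flip: power_mult)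
  ultimately show ?thesis
    using m by (simp add: det_mult[OF pencil_mat_carrier col_kron_carrier]
        det_mult[OF row_kron_carrier pencil_mat_carrier] det_col_kron[OF tri] det_row_kron[OF tri])
qed

text \<open>\<open>newton_basis m q c (m - p) i\<close> is the coefficient of \<open>(q - z)^i\<close> in the vector \<open>S_p\<close> determined by
  \<open>S_m = (q - z)^m\<close>, \<open>S_{p+1} = E W_p\<close> and \<open>S_p = (c_p E - D) W_p\<close>.\<close>

fun newton_basis :: "nat \<Rightarrow> 'a \<Rightarrow> (nat \<Rightarrow> 'a) \<Rightarrow> nat \<Rightarrow> nat \<Rightarrow> 'a :: comm_ring_1" where
  "newton_basis m q c 0 i = (if i = m then 1 else 0)"
| "newton_basis m q c (Suc j) i =
     (c (m - Suc j) - of_nat m * (of_nat i - 1)) * newton_basis m q c j i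
     - q * (of_nat (m * Suc m) - of_nat (m * i)) * newton_basis m q c j (Suc i)"

lemma newton_basis_eq_0: "i + j < m \<or> m < i \<Longrightarrow> newton_basis m q c j i = 0"
  by (induction j arbitrary: i) auto

text \<open>This is the lowest coefficient. Only the second summand of the recursion reaches it, and
  step j contributes -q (N - m (m - j - 1)) = -q m (j + 2).\<close>

lemma newton_basis_diag:
  "j \<le> m \<Longrightarrow> newton_basis m q c j (m - j) = (- q * of_nat m) ^ j * of_nat (fact (Suc j))"
proof (induction j)
  case (Suc j)
  have "of_nat (m * Suc m) - of_nat (m * (m - Suc j)) = (of_nat m * of_nat (Suc (Suc j)) :: 'a)"
  proof -
    obtain l where "m = Suc j + l" using Suc.prems le_Suc_ex by blast
    thus ?thesis by (simp add: algebra_simps)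
  qed
  moreover have "newton_basis m q c j (m - Suc j) = 0"
    using Suc.prems by (intro newton_basis_eq_0) auto
  moreover have "Suc (m - Suc j) = m - j" using Suc.prems by simp
  ultimately show ?case using Suc by (simp add: algebra_simps)
qed simp

lemma newton_basis_rec:
  assumes "p < m"
  shows "newton_basis m q c (m - p) i =
    (c p - of_nat m * (of_nat i - 1)) * newton_basis m q c (m - Suc p) i
     - q * (of_nat (m * Suc m) - of_nat (m * i)) * newton_basis m q c (m - Suc p) (Suc i)"
proof -
  have "m - p = Suc (m - Suc p)" "m - Suc (m - Suc p) = p" using assms by auto
  thus ?thesis by simp
qed

text \<open>Let d_j be the lowest coefficients and P the product of d_j over j < m. The base changes
  have determinants P^m on the columns and (P d_m)^(m - 1) on the rows; cancelling P^(m - 1) leaves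
  P and d_m^(m - 1).\<close>

lemma det_power_pencil_eq_newton:
  fixes q :: "'a :: field_char_0"
  assumes m: "m \<ge> 2" and q: "q \<noteq> 0"
  shows "(\<Prod>j<m. (- q * of_nat m) ^ j * fact (Suc j)) * det (pencil_mat m a b y newton_E (power_D m q) \<phi>) =
    ((- q * of_nat m) ^ m * fact (Suc m)) ^ (m - 1) * det (pencil_mat m a b y newton_E (newton_D c)
      (\<lambda>p. \<Sum>i<m. \<phi> i * newton_basis m q c (m - Suc p) (Suc i)))"
proof -
  \<comment> \<open>The columns of \<open>W\<close> are the vectors S_p. As E raises the power of q
    - z by one, S_{p+1} = E W_p makes the columns of \<open>U\<close> index-shifted copies.\<close>
  define U where "U = (\<lambda>i p. newton_basis m q c (m - Suc p) (Suc i))"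
  define W where "W = (\<lambda>i p. newton_basis m q c (m - p) i)"
  define d where "d j = (- q * of_nat m) ^ j * (fact (Suc j) :: 'a)" for j
  let ?M = "pencil_mat m a b y newton_E (power_D m q) \<phi>"
  let ?M' = "pencil_mat m a b y newton_E (newton_D c) (\<lambda>p. \<Sum>i<m. \<phi> i * U i p)"
  have prod_eq: "?M * col_kron m U = row_kron m W * ?M'"
  proof (rule pencil_mat_change_basis[OF m])
    fix R p assume R: "R \<le> m" and p: "p < m"
    show "(\<Sum>C<m. newton_E R C * U C p) = (\<Sum>R'\<le>m. W R R' * newton_E R' p)"
      using R p by (cases R) (simp_all add: sum_newton_E_row sum_newton_E U_def W_def newton_basis_eq_0)
    have "U m p = 0" by (simp add: U_def newton_basis_eq_0)
    hence "(\<Sum>C<m. power_D m q R C * U C p) = (if R = 0 then 0 else of_nat (m * (R - 1)) * U (R - 1) p)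
        + q * (of_nat (m * Suc m) - of_nat (m * R)) * U R p"
      by (rule sum_power_D_row[OF R])
    also have "\<dots> = c p * W R (Suc p) - W R p"
      using p by (cases R) (simp_all add: W_def U_def newton_basis_eq_0 newton_basis_rec algebra_simps)
    also have "\<dots> = (\<Sum>R'\<le>m. W R R' * newton_D c R' p)"
      by (rule sum_newton_D[OF p, symmetric])
    finally show "(\<Sum>C<m. power_D m q R C * U C p) = (\<Sum>R'\<le>m. W R R' * newton_D c R' p)" .
  qed simp
  have tri: "triangular m U" "triangular (Suc m) W"
    unfolding triangular_def U_def W_def by (auto intro!: newton_basis_eq_0)
  have dU: "(\<Prod>p<m. U p p ^ m) = (\<Prod>j<m. d j) ^ m"
  proof -
    have "(\<Prod>p<m. U p p) = (\<Prod>j<m. U (m - Suc j) (m - Suc j))"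
      by (rule prod.nat_diff_reindex[symmetric])
    also have "\<dots> = (\<Prod>j<m. d j)"
    proof (intro prod.cong refl)
      fix j assume "j \<in> {..<m}"
      hence j: "j \<le> m" "Suc (m - Suc j) = m - j" "m - (m - j) = j" by auto
      show "U (m - Suc j) (m - Suc j) = d j"
        unfolding U_def d_def j(2,3) newton_basis_diag[OF j(1)] by (simp only: of_nat_fact)
    qed
    finally show ?thesis by (simp flip: prod_power_distrib)
  qed
  have dW: "(\<Prod>R\<le>m. W R R ^ (m - 1)) = ((\<Prod>j<m. d j) * d m) ^ (m - 1)"
  proof -
    have "(\<Prod>R\<le>m. W R R) = (\<Prod>j<Suc m. W (Suc m - Suc j) (Suc m - Suc j))"
      using prod.nat_diff_reindex[of "\<lambda>R. W R R" "Suc m"] by (simp only: lessThan_Suc_atMost)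
    also have "\<dots> = (\<Prod>j<Suc m. d j)"
    proof (intro prod.cong refl)
      fix j assume "j \<in> {..<Suc m}"
      hence j: "j \<le> m" "Suc m - Suc j = m - j" "m - (m - j) = j" by auto
      show "W (Suc m - Suc j) (Suc m - Suc j) = d j"
        unfolding W_def d_def j(2,3) newton_basis_diag[OF j(1)] by (simp only: of_nat_fact)
    qed
    finally show ?thesis by (simp flip: prod_power_distrib)
  qed
  have P: "(\<Prod>j<m. d j) ^ m = (\<Prod>j<m. d j) ^ (m - 1) * (\<Prod>j<m. d j)"
    using m by (intro power_minus_mult[symmetric]) simp
  have "det ?M * (\<Prod>j<m. d j) ^ m = ((\<Prod>j<m. d j) * d m) ^ (m - 1) * det ?M'"
    using arg_cong[OF prod_eq, of det]
    by (simp only: det_mult[OF pencil_mat_carrier col_kron_carrier]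
        det_mult[OF row_kron_carrier pencil_mat_carrier] det_col_kron[OF tri(1)]
        det_row_kron[OF tri(2) m] dU dW)
  hence "(\<Prod>j<m. d j) ^ (m - 1) * ((\<Prod>j<m. d j) * det ?M) = (\<Prod>j<m. d j) ^ (m - 1) * (d m ^ (m - 1) * det ?M')"
    unfolding P power_mult_distrib by (simp only: mult_ac)
  moreover have "(\<Prod>j<m. d j) ^ (m - 1) \<noteq> 0" using q m by (simp add: d_def del: fact_Suc)
  ultimately have "(\<Prod>j<m. d j) * det ?M = d m ^ (m - 1) * det ?M'" by (simp only: mult_cancel_left) simp
  thus ?thesis unfolding d_def U_def .
qed

text \<open>Let \<psi> send (q - z)^(p+1) to \<open>\<phi> p\<close>. The hypothesis says \<psi>(D
  v) = \<gamma> \<psi>(E v) for v = (q - z)^(p+1), so \<psi> acts as evaluation at x = \<gamma>, and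
  each step S_p = (c_p E - D) W_p contributes the factor c_p - \<gamma>.\<close>

lemma newton_basis_functional:
  fixes q :: "'a :: field_char_0"
  assumes m: "m \<ge> 1" and \<phi>: "\<And>p. Suc p < m \<Longrightarrow>
      \<phi> p * (q * (of_nat (m * Suc m) - of_nat (m * Suc p))) = (\<gamma> - of_nat (m * Suc p)) * \<phi> (Suc p)"
  shows "(\<Sum>i<m. \<phi> i * newton_basis m q c (m - 1) (Suc i)) = (\<Prod>p = 1..<m. c p - \<gamma>) * \<phi> (m - 1)"
proof -
  have "(\<Sum>i<m. \<phi> i * newton_basis m q c j (Suc i)) = (\<Prod>p = m - j..<m. c p - \<gamma>) * \<phi> (m - 1)"
    if "j < m" for j using that
  proof (induction j)
    case 0
    have "(\<Sum>i<m. \<phi> i * newton_basis m q c 0 (Suc i)) = (\<Sum>i<m. if i = m - 1 then \<phi> i else 0)"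
      using m by (intro sum.cong refl) auto
    thus ?case using m by simp
  next
    case (Suc j)
    let ?n = "\<lambda>i. newton_basis m q c j (Suc i)" and ?c = "c (m - Suc j)"
    have "(\<Sum>i<m. \<phi> i * (q * (of_nat (m * Suc m) - of_nat (m * Suc i))) * ?n (Suc i))
        = (\<Sum>i<m. (\<gamma> - of_nat (m * i)) * \<phi> i * ?n i)"
    proof -
      obtain l where l: "m = Suc l" using m by (cases m) auto
      \<comment> \<open>Both boundary terms vanish by the support of the Newton vectors, so the
        recursion for \<open>\<phi>\<close>, valid for Suc i < m, applies to every remaining
        term.\<close>
      have "?n 0 = 0" "?n m = 0" using Suc.prems by (auto intro!: newton_basis_eq_0)
      hence "(\<Sum>i<m. \<phi> i * (q * (of_nat (m * Suc m) - of_nat (m * Suc i))) * ?n (Suc i))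
          = (\<Sum>i<l. \<phi> i * (q * (of_nat (m * Suc m) - of_nat (m * Suc i))) * ?n (Suc i))"
        unfolding l by (simp del: of_nat_mult of_nat_Suc of_nat_add)
      also have "\<dots> = (\<Sum>i<l. (\<gamma> - of_nat (m * Suc i)) * \<phi> (Suc i) * ?n (Suc i))"
      proof (intro sum.cong refl)
        fix i assume "i \<in> {..<l}"
        hence "Suc i < m" using l by simp
        thus "\<phi> i * (q * (of_nat (m * Suc m) - of_nat (m * Suc i))) * ?n (Suc i)
          = (\<gamma> - of_nat (m * Suc i)) * \<phi> (Suc i) * ?n (Suc i)"
          by (simp only: \<phi>)
      qed
      also have "\<dots> = (\<Sum>i<m. (\<gamma> - of_nat (m * i)) * \<phi> i * ?n i)"
        using \<open>?n 0 = 0\<close> unfolding l sum.lessThan_Suc_shift by simp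
      finally show ?thesis .
    qed
    moreover have "(\<Sum>i<m. \<phi> i * newton_basis m q c (Suc j) (Suc i)) =
        (\<Sum>i<m. (?c - of_nat (m * i)) * \<phi> i * ?n i)
        - (\<Sum>i<m. \<phi> i * (q * (of_nat (m * Suc m) - of_nat (m * Suc i))) * ?n (Suc i))"
      by (simp add: sum_subtractf[symmetric] algebra_simps)
    ultimately have "(\<Sum>i<m. \<phi> i * newton_basis m q c (Suc j) (Suc i)) = (?c - \<gamma>) * (\<Sum>i<m. \<phi> i * ?n i)"
      by (simp add: sum_subtractf[symmetric] sum_distrib_left algebra_simps)
    also have "\<dots> = (?c - \<gamma>) * (\<Prod>p = m - j..<m. c p - \<gamma>) * \<phi> (m - 1)" using Suc by simp
    also have "(?c - \<gamma>) * (\<Prod>p = m - j..<m. c p - \<gamma>) = (\<Prod>p = m - Suc j..<m. c p - \<gamma>)"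
      using Suc.prems by (subst prod.atLeast_Suc_lessThan[of "m - Suc j"]) (auto simp: Suc_diff_Suc)
    finally show ?case .
  qed
  from this[of "m - 1"] m show ?thesis by simp
qed

section \<open>The first row\<close>

text \<open>Rising factorials are the form needed for Chu-Vandermonde.\<close>

lemma of_nat_prod_pred_eq_pochhammer:
  assumes "k \<ge> 1"
  shows "of_nat (\<Prod>i\<in>{1..n}. 4 * i * k - 1) =
    of_nat (4 * k) ^ n * pochhammer (1 - 1 / of_nat (4 * k) :: 'a :: field_char_0) n"
proof (induction n)
  case (Suc n)
  have "of_nat (4 * Suc n * k - 1) = (of_nat (4 * k) * (1 - 1 / of_nat (4 * k) + of_nat n) :: 'a)"
    using assms by (subst of_nat_diff) (auto simp: field_simps)
  note e = this
  have f: "(\<Prod>i\<in>{1..Suc n}. 4 * i * k - 1) = (\<Prod>i\<in>{1..n}. 4 * i * k - 1) * (4 * Suc n * k - 1)"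
    by (simp only: prod.cl_ivl_Suc) simp
  show ?case
    by (subst f, subst of_nat_mult, subst Suc, subst e) (simp only: pochhammer_Suc power_Suc mult_ac)
qed simp

lemma of_nat_prod_succ_eq_pochhammer:
  assumes "k \<ge> 1"
  shows "of_nat (\<Prod>i\<in>{1..n}. 4 * i * k + 1) =
    of_nat (4 * k) ^ n * pochhammer (1 + 1 / of_nat (4 * k) :: 'a :: field_char_0) n"
proof (induction n)
  case (Suc n)
  have "of_nat (4 * Suc n * k + 1) = (of_nat (4 * k) * (1 + 1 / of_nat (4 * k) + of_nat n) :: 'a)"
    using assms by (auto simp: field_simps)
  note e = this
  have f: "(\<Prod>i\<in>{1..Suc n}. 4 * i * k + 1) = (\<Prod>i\<in>{1..n}. 4 * i * k + 1) * (4 * Suc n * k + 1)"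
    by (simp only: prod.cl_ivl_Suc) simp
  show ?case
    by (subst f, subst of_nat_mult, subst Suc, subst e) (simp only: pochhammer_Suc power_Suc mult_ac)
qed simp

text \<open>The signs of \<open>uu\<close> and \<open>power_basis\<close> cancel and the powers of q
  combine. What remains is a Chu-Vandermonde sum, after the factor common to all C \<le> p is split
  off the first rising factorial.\<close>

lemma sum_uu_power_basis:
  fixes q :: "'a :: field_char_0"
  assumes k: "k \<ge> 1" and m: "m = 4 * k" and q: "q = (-4) ^ k" and p: "p < m"
  shows "(\<Sum>C<m. uu k (Suc C) * power_basis q C p) =
    of_nat (2 * (m * Suc m)) * q ^ (p + 2) * of_nat m ^ (m - 1)
      * pochhammer (1 - 1 / of_nat m) (m - 1 - p) * pochhammer (of_nat (m + 1 - p)) p"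
proof -
  let ?x = "1 - 1 / of_nat m :: 'a" and ?y = "1 + 1 / of_nat m :: 'a"
  let ?K = "of_nat (2 * (m * Suc m)) * q ^ (p + 2) * of_nat m ^ (m - 1) * pochhammer ?x (m - 1 - p)"
  have "(\<Sum>C<m. uu k (Suc C) * power_basis q C p) = (\<Sum>C\<le>p. uu k (Suc C) * power_basis q C p)"
    using p by (intro sum.mono_neutral_right) (auto simp: power_basis_eq_0)
  also have "\<dots> = (\<Sum>C\<le>p. ?K * (of_nat (p choose C) * pochhammer ?y C * pochhammer (?x + of_nat (m - 1 - p)) (p - C)))"
  proof (intro sum.cong refl)
    fix C assume "C \<in> {..p}"
    hence C: "C \<le> p" by simp
    have u: "uu k (Suc C) = (-1) ^ C * q ^ (C + 2) * of_nat (2 * (m * Suc m)) *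
        (of_nat m ^ (m - 1 - C) * pochhammer ?x (m - 1 - C)) * (of_nat m ^ C * pochhammer ?y C)"
    proof -
      have "(-4) ^ ((Suc C + 1) * k) = q ^ (C + 2)"
        unfolding q power_mult[symmetric] by (simp add: mult.commute)
      moreover have "8 * k * (4 * k + 1) = 2 * (m * Suc m)" "4 * k - Suc C = m - 1 - C" "Suc C - 1 = C"
        by (simp_all add: m)
      ultimately show ?thesis
        unfolding uu_def of_nat_prod_pred_eq_pochhammer[OF k] of_nat_prod_succ_eq_pochhammer[OF k]
        by (simp only: m)
    qed
    have "m - 1 - C = (m - 1 - p) + (p - C)" using C p by simp
    hence x: "pochhammer ?x (m - 1 - C) = pochhammer ?x (m - 1 - p) * pochhammer (?x + of_nat (m - 1 - p)) (p - C)"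
      by (metis pochhammer_product')
    have 1: "q ^ (C + 2) * q ^ (p - C) = q ^ (p + 2)" using C by (simp flip: power_add)
    have 2: "of_nat m ^ (m - 1 - C) * of_nat m ^ C = (of_nat m ^ (m - 1) :: 'a)"
      using C p by (simp flip: power_add)
    have 3: "(-1) ^ C * (-1) ^ C = (1 :: 'a)" by (simp flip: power_add)
    have "uu k (Suc C) * power_basis q C p = of_nat (2 * (m * Suc m)) * (q ^ (C + 2) * q ^ (p - C))
        * (of_nat m ^ (m - 1 - C) * of_nat m ^ C) * ((-1) ^ C * (-1) ^ C)
        * pochhammer ?x (m - 1 - p) * (of_nat (p choose C) * pochhammer ?y C * pochhammer (?x + of_nat (m - 1 - p)) (p - C))"
      unfolding u x power_basis_eq by (simp only: mult_ac)
    thus "uu k (Suc C) * power_basis q C p =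
        ?K * (of_nat (p choose C) * pochhammer ?y C * pochhammer (?x + of_nat (m - 1 - p)) (p - C))"
      unfolding 1 2 3 by simp
  qed
  also have "\<dots> = ?K * pochhammer (?y + (?x + of_nat (m - 1 - p))) p"
    by (simp only: pochhammer_binomial_sum[of ?y "?x + of_nat (m - 1 - p)"] sum_distrib_left)
  \<comment> \<open>The fractions 1/m cancel, so the closed form has an integral parameter.\<close>
  also have "?y + (?x + of_nat (m - 1 - p)) = of_nat (m + 1 - p)"
    using p by (simp add: of_nat_diff)
  finally show ?thesis .
qed

text \<open>The recursion required by \<open>newton_basis_functional\<close>, with \<gamma> = m^2 -
  1; it comes from the quotient of consecutive closed forms.\<close>

lemma uu_functional_rec:
  fixes q :: "'a :: field_char_0"
  assumes k: "k \<ge> 1" and m: "m = 4 * k" and q: "q = (-4) ^ k" and p: "Suc p < m"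
  defines "\<phi> \<equiv> \<lambda>p. \<Sum>C<m. uu k (Suc C) * power_basis q C p"
  shows "\<phi> p * (q * (of_nat (m * Suc m) - of_nat (m * Suc p))) =
    (of_nat (m * m) - 1 - of_nat (m * Suc p)) * \<phi> (Suc p)"
proof -
  obtain j where j: "m = Suc (Suc p) + j" using p by (metis Suc_leI le_Suc_ex)
  have m0: "of_nat m \<noteq> (0 :: 'a)" using p by simp
  have p1: "\<phi> p = of_nat (2 * (m * Suc m)) * q ^ (p + 2) * of_nat m ^ (m - 1)
      * (pochhammer (1 - 1 / of_nat m) j * (1 - 1 / of_nat m + of_nat j)) * pochhammer (of_nat (m + 1 - p)) p"
    unfolding \<phi>_def using sum_uu_power_basis[OF k m q, of p] p j by (simp add: pochhammer_Suc)
  have p2: "\<phi> (Suc p) = of_nat (2 * (m * Suc m)) * (q * q ^ (p + 2)) * of_nat m ^ (m - 1)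
      * pochhammer (1 - 1 / of_nat m) j * (of_nat (m - p) * pochhammer (of_nat (m + 1 - p)) p)"
    unfolding \<phi>_def using sum_uu_power_basis[OF k m q p] j by (simp add: pochhammer_rec add.commute)
  have "of_nat (m * Suc m) - of_nat (m * Suc p) = (of_nat m * of_nat (m - p) :: 'a)"
    using p by (simp add: of_nat_diff algebra_simps)
  moreover have "of_nat (m * m) - 1 - of_nat (m * Suc p) = (of_nat m * (1 - 1 / of_nat m + of_nat j) :: 'a)"
    using m0 by (simp add: j field_simps)
  ultimately show ?thesis unfolding p1 p2 by (simp only: mult_ac)
qed

lemma uu_functional_last:
  fixes q :: "'a :: field_char_0"
  assumes k: "k \<ge> 1" and m: "m = 4 * k" and q: "q = (-4) ^ k"
  shows "(\<Sum>C<m. uu k (Suc C) * power_basis q C (m - 1)) =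
    of_nat (2 * (m * Suc m)) * q ^ (m + 1) * of_nat m ^ (m - 1) * fact m"
proof -
  obtain l where l: "m = Suc l" using k m not0_implies_Suc[of m] by auto
  have "fact m = (pochhammer 2 l :: 'a)" unfolding l pochhammer_fact pochhammer_rec by simp
  thus ?thesis using sum_uu_power_basis[OF k m q, of "m - 1"] l by simp
qed

section \<open>The determinant over a field\<close>

text \<open>The second argument of \<open>ff1\<close> and \<open>gg1\<close> is m times a block
  index plus t. The block part yields D, and the shift of X1 by (t + 1/2) Y absorbs the rest, so D
  does not depend on t.\<close>

lemma ff1_gg1_eq:
  fixes X1 X2 Y :: "nat \<Rightarrow> 'a :: field_char_0"
  shows "(if C = R then ff1 k X1 X2 Y t (4 * R * k + t)
      else if Suc C = R then gg1 k X1 X2 Y t (4 * C * k + t) else 0) =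
    4 * ((X1 t - (of_nat t + 1 / 2) * Y t) * init_E ((- 4) ^ k) R C - Y t * init_D (4 * k) ((- 4) ^ k) R C)"
proof -
  define q :: 'a where "q = (-4) ^ k"
  have "- (of_nat (4 * NN k + 4 * (4 * R * k + t) + 2) * Y t - 4 * X1 t) * q =
    4 * ((X1 t - (of_nat t + 1 / 2) * Y t) * q - Y t * (q * of_nat (4 * k * Suc (4 * k) + 4 * k * R)))"
    unfolding NN_def by (simp add: field_simps)
  moreover have "- (4 * X1 t - of_nat (4 * (4 * C * k + t) + 2) * Y t) =
    4 * ((X1 t - (of_nat t + 1 / 2) * Y t) * -1 - Y t * - of_nat (4 * k * C))"
    by (simp add: field_simps)
  ultimately show ?thesis
    by (auto simp: ff1_def gg1_def init_E_def init_D_def q_def[symmetric] simp del: of_nat_add of_nat_mult)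
qed

lemma ff0_gg0_eq:
  fixes X1 X2 Y :: "nat \<Rightarrow> 'a :: field_char_0"
  shows "(if C = R then ff0 k X1 X2 Y t (4 * R * k + (t + 1))
      else if Suc C = R then gg0 k X1 X2 Y t (4 * C * k + (t + 1)) else 0) =
    - ((X2 t - of_nat (Suc t) * Y t) * init_E ((- 4) ^ k) R C - Y t * init_D (4 * k) ((- 4) ^ k) R C)"
proof -
  define q :: 'a where "q = (-4) ^ k"
  have "(of_nat (NN k + (4 * R * k + (t + 1))) * Y t - X2 t) * q =
    - ((X2 t - of_nat (Suc t) * Y t) * q - Y t * (q * of_nat (4 * k * Suc (4 * k) + 4 * k * R)))"
    unfolding NN_def by (simp add: field_simps)
  moreover have "X2 t - of_nat (4 * C * k + (t + 1)) * Y t =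
    - ((X2 t - of_nat (Suc t) * Y t) * -1 - Y t * - of_nat (4 * k * C))"
    by (simp add: field_simps)
  ultimately show ?thesis
    by (auto simp: ff0_def gg0_def init_E_def init_D_def q_def[symmetric] simp del: of_nat_add of_nat_mult of_nat_Suc)
qed

lemma MX_eq_pencil_mat:
  fixes X1 X2 Y :: "nat \<Rightarrow> 'a :: field_char_0"
  assumes k: "k \<ge> 1"
  shows "MX k X1 X2 Y = pencil_mat (4 * k) (\<lambda>t. X1 t - (of_nat t + 1 / 2) * Y t)
    (\<lambda>t. X2 t - of_nat (Suc t) * Y t) Y (init_E ((-4) ^ k)) (init_D (4 * k) ((-4) ^ k)) (\<lambda>C. uu k (Suc C))"
proof (rule eq_matI, goal_cases)
  case (1 r c)
  hence rc: "r < 4 * k * (4 * k)" "c < 4 * k * (4 * k)" by (simp_all add: pencil_mat_def)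
  obtain C s where C: "C < 4 * k" "s < 4 * k" "c = C * (4 * k) + s" using rc(2) by (metis col_indexE)
  have dm: "c div (4 * k) = C" "c mod (4 * k) = s" using C by auto
  have sq: "16 * k\<^sup>2 = 4 * k * (4 * k)" by (simp add: power2_eq_square)
  have M: "MX k X1 X2 Y $$ (r, c) = MX_entry k X1 X2 Y r c" using rc by (simp add: MX_def sq)
  have "2 \<le> 4 * k" using k by simp
  from rc(1) this show ?case
  proof (cases rule: row_indexE)
    case 1
    thus ?thesis using C dm unfolding M by (simp add: MX_entry_def pencil_mat_0)
  next
    case (2 R t)
    have dm': "(R * (4 * k - 1) + t) div (4 * k - 1) = R" "(R * (4 * k - 1) + t) mod (4 * k - 1) = t"
      using 2 by auto
    have me: "MX_entry k X1 X2 Y r c = (if C = R then FX k X1 X2 Y (Suc R) (Suc t) (Suc s)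
        else if Suc C = R then GX k X1 X2 Y (Suc C) (Suc t) (Suc s) else 0)"
      unfolding MX_entry_def Let_def 2(3) dm diff_Suc_1 dm' by simp
    consider "s = t" | "s = Suc t" | "s \<noteq> t" "s \<noteq> Suc t" by blast
    thus ?thesis
    proof cases
      case a: 1
      have "MX_entry k X1 X2 Y r c = (if C = R then ff1 k X1 X2 Y (Suc t) (4 * R * k + Suc t)
          else if Suc C = R then gg1 k X1 X2 Y (Suc t) (4 * C * k + Suc t) else 0)"
        unfolding me FX_def GX_def using a by auto
      also have "\<dots> = 4 * ((X1 (Suc t) - (of_nat (Suc t) + 1 / 2) * Y (Suc t)) * init_E ((- 4) ^ k) R C
          - Y (Suc t) * init_D (4 * k) ((- 4) ^ k) R C)"
        by (rule ff1_gg1_eq)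
      finally show ?thesis unfolding M using 2 C a by (simp add: pencil_mat_Suc del: One_nat_def right_diff_distrib_numeral)
    next
      case a: 2
      have "MX_entry k X1 X2 Y r c = (if C = R then ff0 k X1 X2 Y (Suc t) (4 * R * k + Suc t + 1)
          else if Suc C = R then gg0 k X1 X2 Y (Suc t) (4 * C * k + Suc t + 1) else 0)"
        unfolding me FX_def GX_def using a by auto
      also have "\<dots> = - ((X2 (Suc t) - of_nat (Suc (Suc t)) * Y (Suc t)) * init_E ((- 4) ^ k) R C
          - Y (Suc t) * init_D (4 * k) ((- 4) ^ k) R C)"
        using ff0_gg0_eq[of C R k X1 X2 Y "Suc t"] by (simp only: add.assoc)
      finally show ?thesis unfolding M using 2 C a by (simp add: pencil_mat_Suc del: One_nat_def add_Suc_right)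
    next
      case a: 3
      have "MX_entry k X1 X2 Y r c = 0"
        unfolding me FX_def GX_def using a by auto
      thus ?thesis unfolding M using 2 C a by (simp add: pencil_mat_Suc del: One_nat_def)
    qed
  qed
qed (simp_all add: MX_def, simp_all add: power2_eq_square)

section \<open>Collection of the scalar factors\<close>

lemma prod_triangle:
  fixes f :: "nat \<Rightarrow> 'a :: comm_monoid_mult"
  shows "(\<Prod>b\<in>{1..n}. \<Prod>a\<in>{1..b}. f a) = (\<Prod>a\<in>{1..n}. f a ^ (Suc n - a))"
proof (induction n)
  case (Suc n)
  have "(\<Prod>a\<in>{1..Suc n}. f a ^ (Suc (Suc n) - a)) = (\<Prod>a\<in>{1..Suc n}. f a ^ (Suc n - a) * f a)"
    by (intro prod.cong refl) (auto simp: Suc_diff_le mult.commute)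
  also have "\<dots> = (\<Prod>a\<in>{1..n}. f a ^ (Suc n - a)) * (\<Prod>a\<in>{1..Suc n}. f a)"
    by (simp add: prod.distrib mult_ac)
  finally show ?case using Suc by simp
qed simp

text \<open>For fixed t counted from 1, the substitution R = m + 1 - a turns the first case into 1
  \<le> a \<le> t; the other m + 1 - t rows each give 4 y_t.\<close>

lemma prod_newton_factors:
  fixes b y \<alpha> :: "nat \<Rightarrow> 'a :: comm_ring_1"
  shows "(\<Prod>R\<le>m. \<Prod>t<m - 1. if m \<le> R + t then - (b (Suc t) - y (Suc t) * \<alpha> (Suc m - R)) else 4 * y (Suc t))
    = (\<Prod>t\<in>{1..m - 1}. (4 * y t) ^ (Suc m - t) * (\<Prod>a\<in>{1..t}. - (b t - y t * \<alpha> a)))"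
proof -
  have inner: "(\<Prod>R\<le>m. if m \<le> R + t then - (b (Suc t) - y (Suc t) * \<alpha> (Suc m - R)) else 4 * y (Suc t))
    = (4 * y (Suc t)) ^ (m - t) * (\<Prod>a\<in>{1..Suc t}. - (b (Suc t) - y (Suc t) * \<alpha> a))" if t: "t < m" for t
  proof -
    let ?f = "\<lambda>R. if m \<le> R + t then - (b (Suc t) - y (Suc t) * \<alpha> (Suc m - R)) else 4 * y (Suc t)"
    have "(\<Prod>R\<le>m. ?f R) = (\<Prod>i<Suc m. ?f (Suc m - Suc i))"
      using prod.nat_diff_reindex[of ?f "Suc m"] by (simp only: lessThan_Suc_atMost)
    also have "\<dots> = (\<Prod>i\<in>{0..<Suc t}. ?f (Suc m - Suc i)) * (\<Prod>i\<in>{Suc t..<Suc m}. ?f (Suc m - Suc i))"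
      using t by (simp only: lessThan_atLeast0 prod.atLeastLessThan_concat)
    also have "(\<Prod>i\<in>{0..<Suc t}. ?f (Suc m - Suc i)) = (\<Prod>i\<in>{0..<Suc t}. - (b (Suc t) - y (Suc t) * \<alpha> (Suc i)))"
      using t by (intro prod.cong refl) auto
    also have "\<dots> = (\<Prod>a\<in>{1..Suc t}. - (b (Suc t) - y (Suc t) * \<alpha> a))"
      by (simp only: One_nat_def prod.atLeast1_atMost_eq lessThan_atLeast0)
    also have "(\<Prod>i\<in>{Suc t..<Suc m}. ?f (Suc m - Suc i)) = (\<Prod>i\<in>{Suc t..<Suc m}. 4 * y (Suc t))"
      by (intro prod.cong refl) auto
    also have "\<dots> = (4 * y (Suc t)) ^ (m - t)" by simp
    finally show ?thesis by (simp only: mult.commute)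
  qed
  have "(\<Prod>R\<le>m. \<Prod>t<m - 1. if m \<le> R + t then - (b (Suc t) - y (Suc t) * \<alpha> (Suc m - R)) else 4 * y (Suc t))
    = (\<Prod>t<m - 1. (4 * y (Suc t)) ^ (m - t) * (\<Prod>a\<in>{1..Suc t}. - (b (Suc t) - y (Suc t) * \<alpha> a)))"
    by (subst prod.swap, intro prod.cong refl inner) auto
  also have "\<dots> = (\<Prod>t\<in>{1..m - 1}. (4 * y t) ^ (Suc m - t) * (\<Prod>a\<in>{1..t}. - (b t - y t * \<alpha> a)))"
    by (simp only: One_nat_def prod.atLeast1_atMost_eq diff_Suc_Suc)
  finally show ?thesis .
qed

lemma sum_pred_4k: "k \<ge> 1 \<Longrightarrow> \<Sum>{1..4 * k - 1} = 2 * k * (4 * k - (1::nat))"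
  using gauss_sum_from_Suc_0[of "4 * k - 1", where ?'a = nat] by simp

lemma determinant_power_identity:
  fixes q :: "'a :: field_char_0"
  assumes k: "k \<ge> 1" and m: "m = 4 * k" and q: "q = (-4) ^ k" and e: "e = 2 * k * (4 * k - 1)"
  shows "(- q * of_nat m) ^ e * - (2 * of_nat m * q ^ (m + 1) * of_nat m ^ (m - 1))
      * (4 ^ ((4 * k - 1) * (2 * k + 1)) * (- 1 / 2) ^ e * (1 / 2) ^ (m - 1))
    = (-1) ^ (k - 1) * 4 ^ (2 * k * (4 * k\<^sup>2 + 7 * k + 2)) * of_nat k ^ (2 * k * (4 * k + 1))"
proof -
  \<comment> \<open>Chosen so that e + (m - 1) = 2 f + 1: the halves then combine with the factor 2
    into 4^(-f).\<close>
  define f where "f = 4 * k\<^sup>2 + k - 1"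
  obtain n where n: "k = Suc n" using k by (cases k) auto
  have ev: "even e" by (simp add: e)
  have h: "2 * (1 / 2) ^ (e + (m - 1)) * 4 ^ f = (1 :: 'a)"
  proof -
    have "e + (m - 1) = Suc (2 * f)" by (simp add: e m f_def n power2_eq_square algebra_simps)
    thus ?thesis by (simp add: power_mult power_one_over)
  qed
  have A: "k * e + (e + 4 * k) + k * (4 * k + 1) + (4 * k - 1) * (2 * k + 1) = 2 * k * (4 * k\<^sup>2 + 7 * k + 2) + f"
    by (simp add: e f_def n power2_eq_square algebra_simps)
  have qe: "q ^ e = 4 ^ (k * e)"
    using ev by (simp add: q flip: power_mult)
  \<comment> \<open>The sign of the theorem arises here, since k (4k + 1) has the parity of
    k.\<close>
  have qm: "- (q ^ (m + 1)) = (-1) ^ (k - 1) * 4 ^ (k * (4 * k + 1))"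
  proof -
    have "q ^ (m + 1) = (-1) ^ (k * (4 * k + 1)) * 4 ^ (k * (4 * k + 1))"
      unfolding q m power_mult[symmetric] by (rule power_minus)
    also have "(-1) ^ (k * (4 * k + 1)) = ((-1) ^ k :: 'a)"
      by (simp add: power_mult power_add algebra_simps minus_one_power_iff)
    finally show ?thesis by (simp add: n)
  qed
  have mm: "of_nat m ^ e * (of_nat m * of_nat m ^ (m - 1)) = (4 ^ (e + 4 * k) * of_nat k ^ (e + 4 * k) :: 'a)"
  proof -
    have "of_nat m ^ (m - 1) * of_nat m = (of_nat m ^ m :: 'a)"
      using k m by (intro power_minus_mult) simp
    hence "of_nat m ^ e * (of_nat m * of_nat m ^ (m - 1)) = (of_nat m ^ (e + m) :: 'a)"
      by (simp only: power_add mult.commute)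
    thus ?thesis by (simp add: m power_mult_distrib)
  qed
  have ke: "e + 4 * k = 2 * k * (4 * k + 1)" by (simp add: e n algebra_simps)
  have "(- q * of_nat m) ^ e * - (2 * of_nat m * q ^ (m + 1) * of_nat m ^ (m - 1))
      * (4 ^ ((4 * k - 1) * (2 * k + 1)) * (- 1 / 2) ^ e * (1 / 2) ^ (m - 1))
    = q ^ e * (of_nat m ^ e * (of_nat m * of_nat m ^ (m - 1))) * - (q ^ (m + 1)) * 4 ^ ((4 * k - 1) * (2 * k + 1))
      * (2 * (1 / 2) ^ (e + (m - 1)))"
    using ev by (simp add: power_mult_distrib power_add power_divide mult_ac)
  also have "\<dots> = (-1) ^ (k - 1) * of_nat k ^ (e + 4 * k)
      * 4 ^ (k * e + (e + 4 * k) + k * (4 * k + 1) + (4 * k - 1) * (2 * k + 1)) * (2 * (1 / 2) ^ (e + (m - 1)))"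
    unfolding qe qm mm by (simp only: power_add mult_ac)
  also have "\<dots> = (-1) ^ (k - 1) * of_nat k ^ (e + 4 * k)
      * 4 ^ (2 * k * (4 * k\<^sup>2 + 7 * k + 2)) * (2 * (1 / 2) ^ (e + (m - 1)) * 4 ^ f)"
    unfolding A by (simp only: power_add mult_ac)
  finally show ?thesis unfolding h ke by (simp only: mult_ac mult_1_left mult_1_right)
qed

text \<open>Termwise i! (i + 1)_{m-i+1} = (m + 1)!. This turns the factorials of the base change
  into the product in the theorem.\<close>

lemma prod_fact_pochhammer:
  "(\<Prod>j<m. fact (Suc j)) * (\<Prod>i\<in>{1..m}. pochhammer (of_nat (i + 1)) (m - i + 1))
    = (fact (Suc m) ^ m :: 'a :: field_char_0)"
proof -
  have "(\<Prod>j<m. fact (Suc j)) * (\<Prod>i\<in>{1..m}. pochhammer (of_nat (i + 1)) (m - i + 1))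
    = (\<Prod>i\<in>{1..m}. fact i * pochhammer (of_nat (i + 1)) (m - i + 1) :: 'a)"
    by (simp only: prod.atLeast1_atMost_eq[of "\<lambda>i. fact i"] prod.distrib One_nat_def)
  also have "\<dots> = (\<Prod>i\<in>{1..m}. fact (Suc m))"
  proof (intro prod.cong refl)
    fix i assume "i \<in> {1..m}"
    hence "Suc m = i + (m - i + 1)" by simp
    thus "fact i * pochhammer (of_nat (i + 1)) (m - i + 1) = (fact (Suc m) :: 'a)"
      using pochhammer_product'[of "1 :: 'a" i "m - i + 1"] by (simp add: pochhammer_fact add.commute)
  qed
  finally show ?thesis by simp
qed

lemma det_MX_field:
  fixes X1 X2 Y :: "nat \<Rightarrow> 'a :: field_char_0"
  assumes k: "k \<ge> 1" and Y: "\<And>t. Y t \<noteq> 0"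
  shows "det (MX k X1 X2 Y) =
    (-1)^(k-1) * 4^(2*k*(4*k^2+7*k+2)) * of_nat k ^ (2*k*(4*k+1))
    * (\<Prod>i\<in>{1..4*k}. pochhammer (of_nat (i+1)) (4*k-i+1))
    * (\<Prod>a\<in>{1..4*k-1}. 2 * X1 a - of_nat (32*k^2 + 2*a - 1) * Y a)
    * (\<Prod>b\<in>{1..4*k-1}. \<Prod>a\<in>{1..b}.
         2 * X2 b * Y a - 2 * X1 a * Y b - of_nat (2*b - 2*a + 1) * Y a * Y b)"
proof -
  define m q where "m = 4 * k" and "q = ((-4) ^ k :: 'a)"
  define e where "e = 2 * k * (4 * k - 1)"
  define \<alpha> where "\<alpha> t = X1 t / Y t - (of_nat t + 1 / 2)" for t
  define b where "b = (\<lambda>t. X2 t - of_nat (Suc t) * Y t)"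
  define G where "G a b = 2 * X2 b * Y a - 2 * X1 a * Y b - of_nat (2*b - 2*a + 1) * Y a * Y b" for a b
  define H where "H a = 2 * X1 a - of_nat (32*k^2 + 2*a - 1) * Y a" for a
  define \<phi> where "\<phi> = (\<lambda>p. \<Sum>C<m. uu k (Suc C) * power_basis q C p)"
  define \<gamma> :: 'a where "\<gamma> = of_nat (m * m) - 1"
  define T where "T = pencil_mat m (\<lambda>t. Y t * \<alpha> t) b Y newton_E (newton_D (\<lambda>C. \<alpha> (m - C)))
      (\<lambda>p. \<Sum>i<m. \<phi> i * newton_basis m q (\<lambda>C. \<alpha> (m - C)) (m - Suc p) (Suc i))"
  have m: "m \<ge> 2" "4 dvd m" "even m" and q: "q \<noteq> 0" using k by (simp_all add: m_def q_def)
  have "(\<lambda>t. X1 t - (of_nat t + 1 / 2) * Y t) = (\<lambda>t. Y t * \<alpha> t)"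
    using Y by (auto simp: \<alpha>_def algebra_simps)
  hence "det (MX k X1 X2 Y) = det (pencil_mat m (\<lambda>t. Y t * \<alpha> t) b Y newton_E (power_D m q) \<phi>)"
    unfolding MX_eq_pencil_mat[OF k] m_def[symmetric] q_def[symmetric] det_init_pencil_eq_power[OF m(1,2)]
    by (simp only: \<phi>_def b_def)
  hence main: "(\<Prod>j<m. (- q * of_nat m) ^ j * fact (Suc j)) * det (MX k X1 X2 Y) =
      ((- q * of_nat m) ^ m * fact (Suc m)) ^ (m - 1) * det T"
    unfolding T_def by (simp only: det_power_pencil_eq_newton[OF m(1) q])
  have detT: "det T = - ((\<Prod>a\<in>{1..m - 1}. \<alpha> a - \<gamma>) * \<phi> (m - 1))
      * (\<Prod>t\<in>{1..m - 1}. (4 * Y t) ^ (Suc m - t) * (\<Prod>a\<in>{1..t}. - (b t - Y t * \<alpha> a)))"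
  proof -
    have "(\<Sum>i<m. \<phi> i * newton_basis m q (\<lambda>C. \<alpha> (m - C)) (m - 1) (Suc i))
        = (\<Prod>p = 1..<m. \<alpha> (m - p) - \<gamma>) * \<phi> (m - 1)"
    proof (rule newton_basis_functional)
      show "\<phi> p * (q * (of_nat (m * Suc m) - of_nat (m * Suc p))) = (\<gamma> - of_nat (m * Suc p)) * \<phi> (Suc p)"
        if "Suc p < m" for p
        unfolding \<phi>_def \<gamma>_def using uu_functional_rec[OF k m_def q_def that] .
    qed (use m in simp)
    also have "(\<Prod>p = 1..<m. \<alpha> (m - p) - \<gamma>) = (\<Prod>a\<in>{1..m - 1}. \<alpha> a - \<gamma>)"
      by (rule prod.reindex_bij_witness[of _ "\<lambda>a. m - a" "\<lambda>p. m - p"]) (use m in auto)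
    finally show ?thesis
      unfolding T_def det_newton_pencil[OF m(1,3) refl] prod_newton_factors by simp
  qed
  have fG: "- (b t - Y t * \<alpha> a) = (- 1 / 2) * G a t * (1 / Y a)" if at: "a \<in> {1..t}" for a t
  proof -
    \<comment> \<open>Writing t = a + d resolves the truncated subtraction in
      \<open>G\<close>.\<close>
    obtain d where "t = a + d" using at le_Suc_ex[of a t] by auto
    thus ?thesis using Y[of a] unfolding G_def b_def \<alpha>_def by (simp add: field_simps)
  qed
  have fH: "\<alpha> a - \<gamma> = 1 / 2 * H a * (1 / Y a)" if "a \<in> {1..m - 1}" for a
  proof -
    \<comment> \<open>The linear factor has this constant because 2 (\<gamma> + a + 1/2) = 2 m^2 +
      2a - 1.\<close>
    have N: "of_nat (32*k^2 + 2*a - 1) = (2 * of_nat (m * m) + 2 * of_nat a - 1 :: 'a)"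
      using that by (subst of_nat_diff) (auto simp: m_def power2_eq_square)
    show ?thesis using Y[of a] unfolding H_def \<gamma>_def \<alpha>_def N by (simp add: field_simps)
  qed
  have card: "card {1..m - 1} = m - 1" by simp
  have "(\<Prod>a\<in>{1..m - 1}. \<alpha> a - \<gamma>) = (1 / 2) ^ (m - 1) * (\<Prod>a\<in>{1..m - 1}. H a) * (\<Prod>a\<in>{1..m - 1}. 1 / Y a)"
  proof -
    have "(\<Prod>a\<in>{1..m - 1}. \<alpha> a - \<gamma>) = (\<Prod>a\<in>{1..m - 1}. 1 / 2 * H a * (1 / Y a))"
      by (intro prod.cong refl fH)
    thus ?thesis by (simp only: prod.distrib prod_constant card)
  qed
  moreover have "(\<Prod>t\<in>{1..m - 1}. (4 * Y t) ^ (Suc m - t) * (\<Prod>a\<in>{1..t}. - (b t - Y t * \<alpha> a)))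
      = 4 ^ ((4 * k - 1) * (2 * k + 1)) * (\<Prod>t\<in>{1..m - 1}. Y t ^ (Suc m - t)) * (- 1 / 2) ^ e
        * (\<Prod>t\<in>{1..m - 1}. \<Prod>a\<in>{1..t}. G a t) * (\<Prod>a\<in>{1..m - 1}. (1 / Y a) ^ (m - a))"
  proof -
    have "(\<Prod>a\<in>{1..t}. - (b t - Y t * \<alpha> a)) = (- 1 / 2) ^ t * (\<Prod>a\<in>{1..t}. G a t) * (\<Prod>a\<in>{1..t}. 1 / Y a)" for t
    proof -
      have "(\<Prod>a\<in>{1..t}. - (b t - Y t * \<alpha> a)) = (\<Prod>a\<in>{1..t}. (- 1 / 2) * G a t * (1 / Y a))"
        by (intro prod.cong refl fG)
      thus ?thesis by (simp only: prod.distrib prod_constant card_atLeastAtMost diff_Suc_1)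
    qed
    moreover have "(\<Prod>t\<in>{1..m - 1}. \<Prod>a\<in>{1..t}. 1 / Y a) = (\<Prod>a\<in>{1..m - 1}. (1 / Y a) ^ (m - a))"
      using m by (simp only: prod_triangle) simp
    moreover have "(\<Prod>t\<in>{1..m - 1}. (- 1 / 2) ^ t) = ((- 1 / 2) ^ e :: 'a)"
      using sum_pred_4k[OF k] by (simp only: power_sum[symmetric] m_def e_def)
    moreover have "(\<Prod>t\<in>{1..m - 1}. 4 ^ (Suc m - t)) = (4 ^ ((4 * k - 1) * (2 * k + 1)) :: 'a)"
    proof -
      have "(\<Sum>t\<in>{1..m - 1}. Suc m - t) + \<Sum>{1..m - 1} = (\<Sum>t\<in>{1..m - 1}. Suc m)"
        unfolding sum.distrib[symmetric] by (intro sum.cong refl) auto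
      hence "(\<Sum>t\<in>{1..m - 1}. Suc m - t) + 2 * k * (4 * k - 1) = (4 * k - 1) * Suc (4 * k)"
        using sum_pred_4k[OF k] by (simp add: m_def)
      moreover have "c * Suc (4 * k) = c * (2 * k + 1) + 2 * k * c" for c
        by (simp add: algebra_simps)
      ultimately have "(\<Sum>t\<in>{1..m - 1}. Suc m - t) = (4 * k - 1) * (2 * k + 1)"
        by (metis add_right_cancel)
      thus ?thesis by (simp only: power_sum[symmetric])
    qed
    ultimately show ?thesis by (simp only: prod.distrib power_mult_distrib mult_ac)
  qed
  \<comment> \<open>The m + 1 - t factors Y_t from the entries 4 Y_t cancel the m - t denominators
    of the quadratic factors and the one of the linear factor.\<close>
  moreover have "(\<Prod>t\<in>{1..m - 1}. Y t ^ (Suc m - t)) * (\<Prod>a\<in>{1..m - 1}. (1 / Y a) ^ (m - a)) * (\<Prod>a\<in>{1..m - 1}. 1 / Y a) = 1"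
  proof -
    have "Y t ^ (Suc m - t) * (1 / Y t) ^ (m - t) * (1 / Y t) = 1" if "t \<in> {1..m - 1}" for t
      using that Y[of t] by (auto simp: Suc_diff_le power_divide)
    thus ?thesis unfolding prod.distrib[symmetric] by (intro prod.neutral) blast
  qed
  ultimately have detT': "det T = - \<phi> (m - 1) * (4 ^ ((4 * k - 1) * (2 * k + 1)) * (- 1 / 2) ^ e * (1 / 2) ^ (m - 1))
      * ((\<Prod>a\<in>{1..m - 1}. H a) * (\<Prod>t\<in>{1..m - 1}. \<Prod>a\<in>{1..t}. G a t))"
  proof -
    assume *: "(\<Prod>t\<in>{1..m - 1}. Y t ^ (Suc m - t)) * (\<Prod>a\<in>{1..m - 1}. (1 / Y a) ^ (m - a)) * (\<Prod>a\<in>{1..m - 1}. 1 / Y a) = 1"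
    have "- (x * hh * y1 * p) * (f * y2 * s * g * y3) = - p * (f * s * x) * (hh * g)"
      if "y2 * y3 * y1 = 1" for x hh y1 p f y2 s g y3 :: 'a
    proof -
      have "- (x * hh * y1 * p) * (f * y2 * s * g * y3) = - p * (f * s * x) * (hh * g) * (y2 * y3 * y1)"
        by (simp add: mult_ac)
      thus ?thesis using that by simp
    qed
    from this[OF *] show ?thesis unfolding detT \<open>(\<Prod>a\<in>{1..m - 1}. \<alpha> a - \<gamma>) = _\<close> \<open>prod _ _ = 4 ^ _ * _ * _ * _ * _\<close> .
  qed
  define K :: 'a where "K = (-1)^(k-1) * 4^(2*k*(4*k^2+7*k+2)) * of_nat k ^ (2*k*(4*k+1))"
  define Po :: 'a where "Po = (\<Prod>i\<in>{1..m}. pochhammer (of_nat (i+1)) (m-i+1))"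
  define P :: 'a where "P = (\<Prod>j<m. (- q * of_nat m) ^ j * fact (Suc j))"
  define Z where "Z = (\<Prod>a\<in>{1..m - 1}. H a) * (\<Prod>t\<in>{1..m - 1}. \<Prod>a\<in>{1..t}. G a t)"
  have e_sum: "\<Sum>{..<m} = e"
  proof -
    have "\<Sum>{..<m} = \<Sum>{1..m - 1}"
      by (rule sum.mono_neutral_right) (use m in auto)
    thus ?thesis using sum_pred_4k[OF k] by (simp add: m_def e_def)
  qed
  have P: "P = (- q * of_nat m) ^ e * (\<Prod>j<m. fact (Suc j))"
    unfolding P_def prod.distrib power_sum[symmetric] e_sum ..
  have "P \<noteq> 0" using q m unfolding P by (simp del: fact_Suc)
  have "((- q * of_nat m) ^ m * fact (Suc m)) ^ (m - 1) * - \<phi> (m - 1)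
      * (4 ^ ((4 * k - 1) * (2 * k + 1)) * (- 1 / 2) ^ e * (1 / 2) ^ (m - 1)) = P * (K * Po)"
  proof -
    \<comment> \<open>One power with exponent e belongs to \<open>P\<close>; the other enters
      \<open>determinant_power_identity\<close>.\<close>
    have "m * (m - 1) = e + e" by (simp add: m_def e_def algebra_simps)
    hence 1: "((- q * of_nat m) ^ m * fact (Suc m)) ^ (m - 1) =
        (- q * of_nat m) ^ e * (- q * of_nat m) ^ e * fact (Suc m) ^ (m - 1)"
      by (simp only: power_mult_distrib power_mult[symmetric] power_add mult_ac)
    have 2: "\<phi> (m - 1) = 2 * of_nat m * q ^ (m + 1) * of_nat m ^ (m - 1) * fact (Suc m)"
      unfolding \<phi>_def uu_functional_last[OF k m_def q_def] by (simp add: algebra_simps)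
    have 3: "fact (Suc m) ^ (m - 1) * fact (Suc m) = (\<Prod>j<m. fact (Suc j)) * Po"
      unfolding Po_def prod_fact_pochhammer using m by (intro power_minus_mult) simp
    have "((- q * of_nat m) ^ m * fact (Suc m)) ^ (m - 1) * - \<phi> (m - 1)
        * (4 ^ ((4 * k - 1) * (2 * k + 1)) * (- 1 / 2) ^ e * (1 / 2) ^ (m - 1))
      = (- q * of_nat m) ^ e * (fact (Suc m) ^ (m - 1) * fact (Suc m)) *
        ((- q * of_nat m) ^ e * - (2 * of_nat m * q ^ (m + 1) * of_nat m ^ (m - 1))
        * (4 ^ ((4 * k - 1) * (2 * k + 1)) * (- 1 / 2) ^ e * (1 / 2) ^ (m - 1)))"
      unfolding 1 2 by (simp only: mult_ac mult_minus_left mult_minus_right)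
    also have "\<dots> = P * (K * Po)"
      unfolding determinant_power_identity[OF k m_def q_def e_def] 3 P K_def by (simp only: mult_ac)
    finally show ?thesis .
  qed
  from arg_cong[OF this, of "\<lambda>x. x * Z"]
  have "((- q * of_nat m) ^ m * fact (Suc m)) ^ (m - 1) * det T = P * (K * Po * Z)"
    unfolding detT' Z_def[symmetric] by (simp only: mult.assoc)
  hence "P * det (MX k X1 X2 Y) = P * (K * Po * Z)"
    using main unfolding P_def by simp
  hence "det (MX k X1 X2 Y) = K * Po * Z" using \<open>P \<noteq> 0\<close> by simp
  thus ?thesis unfolding K_def Po_def Z_def G_def H_def m_def by (simp only: mult.assoc)
qed

section \<open>Arbitrary commutative rings\<close>

text \<open>Makes the field version, which divides by 2, m and Y_t, available over
  fractions.\<close>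

instance fract :: ("{idom, ring_char_0}") field_char_0
proof
  have "(of_nat n :: 'a fract) = Fract (of_nat n) 1" for n
    by (induction n) (simp_all add: Zero_fract_def One_fract_def)
  thus "inj (of_nat :: nat \<Rightarrow> 'a fract)"
    by (auto intro!: injI simp: eq_fract)
qed

section \<open>Integer polynomials and their evaluation in a commutative ring\<close>

definition monom_eval :: "(nat \<Rightarrow> 'a) \<Rightarrow> (nat \<Rightarrow>\<^sub>0 nat) \<Rightarrow> 'a :: comm_ring_1" where
  "monom_eval x e = (\<Prod>i\<in>Poly_Mapping.keys e. x i ^ Poly_Mapping.lookup e i)"

definition mpoly_eval :: "(nat \<Rightarrow> 'a) \<Rightarrow> ((nat \<Rightarrow>\<^sub>0 nat) \<Rightarrow>\<^sub>0 int) \<Rightarrow> 'a :: comm_ring_1" where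
  "mpoly_eval x p = (\<Sum>e\<in>Poly_Mapping.keys p. of_int (Poly_Mapping.lookup p e) * monom_eval x e)"

definition mpoly_var :: "nat \<Rightarrow> (nat \<Rightarrow>\<^sub>0 nat) \<Rightarrow>\<^sub>0 int" where
  "mpoly_var i = Poly_Mapping.single (Poly_Mapping.single i 1) 1"

lemma monom_eval_superset:
  assumes "finite A" "Poly_Mapping.keys e \<subseteq> A"
  shows "monom_eval x e = (\<Prod>i\<in>A. x i ^ Poly_Mapping.lookup e i)"
  unfolding monom_eval_def using assms by (intro prod.mono_neutral_left) (auto simp: in_keys_iff)

lemma monom_eval_add: "monom_eval x (d + e) = monom_eval x d * monom_eval x e"
proof -
  let ?A = "Poly_Mapping.keys d \<union> Poly_Mapping.keys e"
  have "monom_eval x f = (\<Prod>i\<in>?A. x i ^ Poly_Mapping.lookup f i)" if "Poly_Mapping.keys f \<subseteq> ?A" for f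
    using that by (intro monom_eval_superset) auto
  thus ?thesis using keys_add[of d e]
    by (simp add: lookup_add power_add prod.distrib)
qed

lemma mpoly_eval_superset:
  assumes "finite A" "Poly_Mapping.keys p \<subseteq> A"
  shows "mpoly_eval x p = (\<Sum>e\<in>A. of_int (Poly_Mapping.lookup p e) * monom_eval x e)"
  unfolding mpoly_eval_def using assms by (intro sum.mono_neutral_left) (auto simp: in_keys_iff)

lemma mpoly_eval_add: "mpoly_eval x (p + r) = mpoly_eval x p + mpoly_eval x r"
proof -
  let ?A = "Poly_Mapping.keys p \<union> Poly_Mapping.keys r"
  have "mpoly_eval x s = (\<Sum>e\<in>?A. of_int (Poly_Mapping.lookup s e) * monom_eval x e)" if "Poly_Mapping.keys s \<subseteq> ?A" for s
    using that by (intro mpoly_eval_superset) auto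
  thus ?thesis using keys_add[of p r]
    by (simp add: lookup_add sum.distrib algebra_simps)
qed

lemma mpoly_eval_single: "mpoly_eval x (Poly_Mapping.single e c) = of_int c * monom_eval x e"
  by (cases "c = 0") (simp_all add: mpoly_eval_def)

text \<open>Every polynomial is the finite sum of its terms; this reduces multiplicativity of
  evaluation to single terms.\<close>

lemma mpoly_induct [case_names single add]:
  fixes p :: "(nat \<Rightarrow>\<^sub>0 nat) \<Rightarrow>\<^sub>0 int"
  assumes single: "\<And>e c. P (Poly_Mapping.single e c)" and add: "\<And>p r. P p \<Longrightarrow> P r \<Longrightarrow> P (p + r)"
  shows "P p"
proof -
  have "P (\<Sum>e\<in>A. Poly_Mapping.single e (Poly_Mapping.lookup p e))" if "finite A" for A
    using that
  proof (induction A)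
    case empty
    show ?case using single[of 0 0] by simp
  qed (simp add: assms)
  hence "P (\<Sum>e\<in>Poly_Mapping.keys p. Poly_Mapping.single e (Poly_Mapping.lookup p e))" by simp
  also have "(\<Sum>e\<in>Poly_Mapping.keys p. Poly_Mapping.single e (Poly_Mapping.lookup p e)) = p"
    by (rule poly_mapping_eqI) (simp add: lookup_sum lookup_single when_def in_keys_iff)
  finally show ?thesis .
qed

lemma mpoly_eval_mult: "mpoly_eval x (p * r) = mpoly_eval x p * mpoly_eval x r"
proof (induction p rule: mpoly_induct)
  case (single e c)
  show ?case
  proof (induction r rule: mpoly_induct)
    case (single e' c')
    show ?case by (simp add: mult_single mpoly_eval_single monom_eval_add mult_ac)
  qed (simp add: mpoly_eval_add algebra_simps)
qed (simp add: mpoly_eval_add algebra_simps)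

lemma mpoly_eval_comm_ring_hom: "comm_ring_hom (mpoly_eval x)"
proof
  show "mpoly_eval x 1 = 1"
    using mpoly_eval_single[of x 0 1] by (simp add: monom_eval_def)
  show "mpoly_eval x 0 = 0" by (simp add: mpoly_eval_def)
qed (rule mpoly_eval_add mpoly_eval_mult)+

lemma mpoly_eval_var: "mpoly_eval x (mpoly_var i) = x i"
  by (simp add: mpoly_var_def mpoly_eval_single monom_eval_def)

lemma mpoly_var_nonzero: "mpoly_var i \<noteq> 0"
  by (simp add: mpoly_var_def)

section \<open>Transport of the identity along ring homomorphisms\<close>

definition embed_fract :: "'a :: idom \<Rightarrow> 'a fract" where
  "embed_fract x = Fract x 1"

lemma embed_fract_comm_ring_hom: "comm_ring_hom embed_fract"
  by standard (simp_all add: embed_fract_def Zero_fract_def One_fract_def)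

lemma inj_embed_fract: "inj embed_fract"
  by (auto intro!: injI simp: embed_fract_def eq_fract)

definition det_formula :: "nat \<Rightarrow> (nat \<Rightarrow> 'a) \<Rightarrow> (nat \<Rightarrow> 'a) \<Rightarrow> (nat \<Rightarrow> 'a) \<Rightarrow> 'a :: comm_ring_1" where
  "det_formula k X1 X2 Y =
    (-1)^(k-1) * 4^(2*k*(4*k^2+7*k+2)) * of_nat k ^ (2*k*(4*k+1))
    * (\<Prod>i\<in>{1..4*k}. pochhammer (of_nat (i+1)) (4*k-i+1))
    * (\<Prod>a\<in>{1..4*k-1}. 2 * X1 a - of_nat (32*k^2 + 2*a - 1) * Y a)
    * (\<Prod>b\<in>{1..4*k-1}. \<Prod>a\<in>{1..b}.
         2 * X2 b * Y a - 2 * X1 a * Y b - of_nat (2*b - 2*a + 1) * Y a * Y b)"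

context comm_ring_hom
begin

lemma hom_numeral_eq: "hom (numeral n) = numeral n"
  by (metis hom_of_nat of_nat_numeral)

lemma hom_det_formula:
  "hom (det_formula k X1 X2 Y) = det_formula k (\<lambda>t. hom (X1 t)) (\<lambda>t. hom (X2 t)) (\<lambda>t. hom (Y t))"
  \<comment> \<open>Each rising factorial becomes the image of a natural number, which every
    homomorphism preserves.\<close>
  unfolding det_formula_def pochhammer_of_nat
  by (simp only: hom_mult hom_power hom_prod hom_minus hom_uminus hom_one hom_of_nat hom_numeral_eq)

lemma hom_MX: "map_mat hom (MX k X1 X2 Y) = MX k (\<lambda>t. hom (X1 t)) (\<lambda>t. hom (X2 t)) (\<lambda>t. hom (Y t))"
proof (rule eq_matI)
  have "hom (uu k l) = uu k l" for l
    unfolding uu_def by (simp only: hom_mult hom_power hom_uminus hom_one hom_of_nat hom_numeral_eq)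
  moreover have "hom (FX k X1 X2 Y l t s) = FX k (\<lambda>t. hom (X1 t)) (\<lambda>t. hom (X2 t)) (\<lambda>t. hom (Y t)) l t s"
    "hom (GX k X1 X2 Y l t s) = GX k (\<lambda>t. hom (X1 t)) (\<lambda>t. hom (X2 t)) (\<lambda>t. hom (Y t)) l t s" for l t s
    unfolding FX_def GX_def ff0_def ff1_def gg0_def gg1_def
    by (simp_all only: if_distrib[of hom] hom_mult hom_power hom_uminus hom_minus hom_zero hom_of_nat hom_numeral_eq)
  ultimately have "hom (MX_entry k X1 X2 Y r c) =
      MX_entry k (\<lambda>t. hom (X1 t)) (\<lambda>t. hom (X2 t)) (\<lambda>t. hom (Y t)) r c" for r c
    unfolding MX_entry_def Let_def by (simp only: if_distrib[of hom] hom_zero)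
  thus "map_mat hom (MX k X1 X2 Y) $$ (r, c) = MX k (\<lambda>t. hom (X1 t)) (\<lambda>t. hom (X2 t)) (\<lambda>t. hom (Y t)) $$ (r, c)"
    if "r < dim_row (MX k (\<lambda>t. hom (X1 t)) (\<lambda>t. hom (X2 t)) (\<lambda>t. hom (Y t)))"
       "c < dim_col (MX k (\<lambda>t. hom (X1 t)) (\<lambda>t. hom (X2 t)) (\<lambda>t. hom (Y t)))" for r c
    using that by (simp add: MX_def)
qed (simp_all add: MX_def)

end

lemma det_MX_idom:
  fixes X1 X2 Y :: "nat \<Rightarrow> 'a :: {idom, ring_char_0}"
  assumes "k \<ge> 1" "\<And>t. Y t \<noteq> 0"
  shows "det (MX k X1 X2 Y) = det_formula k X1 X2 Y"
proof -
  interpret comm_ring_hom "embed_fract :: 'a \<Rightarrow> 'a fract" by (rule embed_fract_comm_ring_hom)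
  have "embed_fract (Y t) \<noteq> 0" for t
    using assms(2)[of t] inj_embed_fract hom_zero by (metis injD)
  hence "det (MX k (\<lambda>t. embed_fract (X1 t)) (\<lambda>t. embed_fract (X2 t)) (\<lambda>t. embed_fract (Y t))) =
      det_formula k (\<lambda>t. embed_fract (X1 t)) (\<lambda>t. embed_fract (X2 t)) (\<lambda>t. embed_fract (Y t))"
    unfolding det_formula_def by (rule det_MX_field[OF assms(1)])
  hence "embed_fract (det (MX k X1 X2 Y)) = embed_fract (det_formula k X1 X2 Y)"
    unfolding hom_det[symmetric] hom_MX hom_det_formula .
  thus ?thesis using inj_embed_fract by (rule injD[rotated])
qed

theorem theorem2:
  fixes k :: nat and X1 X2 Y :: "nat \<Rightarrow> 'a::comm_ring_1"
  assumes "k \<ge> 1"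
  shows "det (MX k X1 X2 Y) =
    (-1)^(k-1) * 4^(2*k*(4*k^2+7*k+2)) * of_nat k ^ (2*k*(4*k+1))
    * (\<Prod>i\<in>{1..4*k}. pochhammer (of_nat (i+1)) (4*k-i+1))
    * (\<Prod>a\<in>{1..4*k-1}. 2 * X1 a - of_nat (32*k^2 + 2*a - 1) * Y a)
    * (\<Prod>b\<in>{1..4*k-1}. \<Prod>a\<in>{1..b}.
         2 * X2 b * Y a - 2 * X1 a * Y b - of_nat (2*b - 2*a + 1) * Y a * Y b)"
proof -
  \<comment> \<open>The three families are interleaved mod 3 into one assignment of
    variables.\<close>
  define x where "x i = (if i mod 3 = 0 then X1 (i div 3) else if i mod 3 = 1 then X2 (i div 3) else Y (i div 3))" for i
  have x: "mpoly_eval x (mpoly_var (3 * t)) = X1 t" "mpoly_eval x (mpoly_var (3 * t + 1)) = X2 t"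
    "mpoly_eval x (mpoly_var (3 * t + 2)) = Y t" for t
  proof -
    have "3 * t mod 3 = 0" "(3 * t + 1) mod 3 = 1" "(3 * t + 2) mod 3 = 2"
      "3 * t div 3 = t" "(3 * t + 1) div 3 = t" "(3 * t + 2) div 3 = t"
      by presburger+
    thus "mpoly_eval x (mpoly_var (3 * t)) = X1 t" "mpoly_eval x (mpoly_var (3 * t + 1)) = X2 t"
      "mpoly_eval x (mpoly_var (3 * t + 2)) = Y t"
      unfolding mpoly_eval_var x_def by (simp_all del: add_2_eq_Suc')
  qed
  interpret comm_ring_hom "mpoly_eval x" by (rule mpoly_eval_comm_ring_hom)
  let ?X1 = "\<lambda>t. mpoly_var (3 * t)" and ?X2 = "\<lambda>t. mpoly_var (3 * t + 1)" and ?Y = "\<lambda>t. mpoly_var (3 * t + 2)"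
  \<comment> \<open>Each \<open>?Y t\<close> is a variable, hence nonzero; evaluation then removes
    the restriction on \<open>Y\<close>.\<close>
  have "det (MX k ?X1 ?X2 ?Y) = det_formula k ?X1 ?X2 ?Y"
    using assms mpoly_var_nonzero by (rule det_MX_idom)
  hence "mpoly_eval x (det (MX k ?X1 ?X2 ?Y)) = mpoly_eval x (det_formula k ?X1 ?X2 ?Y)" by simp
  hence "det (MX k X1 X2 Y) = det_formula k X1 X2 Y"
    unfolding hom_det[symmetric] hom_MX hom_det_formula x .
  thus ?thesis unfolding det_formula_def .
qed

end
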